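(* Let $\eta\in(0,1)$, $\tau\in[0,1]$, $\alpha\in\mathbb C$, $N_B>0$, $N_T=(1-\eta)N_B$, and let the bipartite resource $\rho_{SI}$ be the split coherent state with parameters $\alpha,\tau$. If $N_T>\frac{\eta\tau|\alpha|^2}2-1$, then $$\chi_{\mathrm{ring}}^{\mathrm{coherent}}\ \ge\ \eta\tau|\alpha|^2\left(\frac1{N_T+1}+\log\frac{N_T+1}{N_T}\right)-\left(N_T+\eta\tau|\alpha|^2\right)\log\left(1+\frac{\eta\tau|\alpha|^2}{N_T(N_T+1)}\right).$$
   Context: All logarithms are natural. Lossy thermal bosonic channel: with transmissivity $\eta\in(0,1)$ and noise mean photon number $N_B$, the channel mixes the input mode $\hat a$ with an environment mode $\hat c$ in the thermal state $\rho_{N_B}=\sum_{n\ge0}\frac{N_B^n}{(N_B+1)^{n+1}}|n\rangle\langle n|$ on a beamsplitter; the accessible output mode is $\hat b=\sqrt\eta\,\hat a+\sqrt{1-\eta}\,\hat c$ and the mode $\hat e=-\sqrt{1-\eta}\,\hat a+\sqrt\eta\,\hat c$ is lost (traced out). With $N_T=(1-\eta)N_B$ this is called the $(\eta,N_T)$-bosonic channel. Split coherent state: $\rho_{SI}$ is the two-mode output of a beamsplitter of transmissivity $\tau$ whose inputs are the coherent state $|\alpha\rangle\langle\alpha|$ and the vacuum; that is, $\rho_{SI}$ is the product of the coherent state of amplitude $\sqrt\tau\,\alpha$ in the signal mode $S$ and the coherent state of amplitude $\sqrt{1-\tau}\,\alpha$ in the idler mode $I$. $\rho_{BI}^{\theta}$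 is the state obtained from $\rho_{SI}$ by applying the phase shift $\theta$ (unitary $e^{i\theta\hat a^\dagger\hat a}$) to the signal mode $S$ and then sending it through the $(\eta,N_T)$-bosonic channel (output mode $B$), the idler $I$ being left unchanged. With $\mathbb H(\rho)=-\mathrm{tr}(\rho\log\rho)$ the von Neumann entropy, the Holevo information of the ring state is $$\chi_{\mathrm{ring}}^{\mathrm{coherent}}=\mathbb H\Big(\frac1{2\pi}\int_0^{2\pi}\rho_{BI}^\theta\,d\theta\Big)-\frac1{2\pi}\int_0^{2\pi}\mathbb H(\rho_{BI}^\theta)\,d\theta .$$ *)

theory Defs
  imports "HOL-Analysis.Analysis" "HOL-Computational_Algebra.Polynomial"
begin

text \<open>
  Operators on the Hilbert space with orthonormal basis indexed by \<open>'i\<close> are represented by their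
  (possibly infinite) matrices. One bosonic mode has the Fock basis indexed by \<^typ>\<open>nat\<close>,
  two modes have the product basis indexed by \<^typ>\<open>nat \<times> nat\<close>.
\<close>

type_synonym 'i oper = "'i \<Rightarrow> 'i \<Rightarrow> complex"

definition op_mult :: "'i oper \<Rightarrow> 'i oper \<Rightarrow> 'i oper" where
  "op_mult A B = (\<lambda>i j. \<Sum>\<^sub>\<infinity>k. A i k * B k j)"

definition op_adj :: "'i oper \<Rightarrow> 'i oper" where
  "op_adj A = (\<lambda>i j. cnj (A j i))"

definition op_diag :: "('i \<Rightarrow> complex) \<Rightarrow> 'i oper" where
  "op_diag d = (\<lambda>i j. if i = j then d i else 0)"

definition op_id :: "'i oper" where
  "op_id = op_diag (\<lambda>_. 1)"

definition op_conjugate :: "'i oper \<Rightarrow> 'i oper \<Rightarrow> 'i oper" where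
  "op_conjugate U A = op_mult U (op_mult A (op_adj U))"

definition op_tensor :: "'i oper \<Rightarrow> 'k oper \<Rightarrow> ('i \<times> 'k) oper" where
  "op_tensor A B = (\<lambda>(i, k) (j, l). A i j * B k l)"

definition partial_trace_snd :: "('i \<times> 'k) oper \<Rightarrow> 'i oper" where
  "partial_trace_snd A = (\<lambda>i j. \<Sum>\<^sub>\<infinity>k. A (i, k) (j, k))"

text \<open>
  The extension \<open>F \<otimes> id\<close> of a linear map \<open>F\<close> on operators: \<open>F\<close> acts on each block obtained by
  fixing the two indices of the second factor.
\<close>

definition map_tensor_id :: "('i oper \<Rightarrow> 'j oper) \<Rightarrow> ('i \<times> 'k) oper \<Rightarrow> ('j \<times> 'k) oper" where
  "map_tensor_id F A = (\<lambda>(i, k) (j, l). F (\<lambda>m n. A (m, k) (n, l)) i j)"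

definition unitary_op :: "'i oper \<Rightarrow> bool" where
  "unitary_op U \<longleftrightarrow> op_mult (op_adj U) U = op_id \<and> op_mult U (op_adj U) = op_id"


subsection \<open>Functional calculus and von Neumann entropy\<close>

text \<open>
  Spectral decomposition of a density operator: the columns of \<open>V\<close> form an orthonormal eigenbasis
  and \<open>p\<close> gives the eigenvalues, repeated with multiplicity (zero eigenvalues included).
\<close>

definition spectral_decomposition :: "'i oper \<Rightarrow> 'i oper \<Rightarrow> ('i \<Rightarrow> real) \<Rightarrow> bool" where
  "spectral_decomposition \<rho> V p \<longleftrightarrow>
     unitary_op V \<and> (\<forall>k. 0 \<le> p k) \<and> (p has_sum 1) UNIV \<and>
     \<rho> = op_conjugate V (op_diag (\<lambda>k. complex_of_real (p k)))"

text \<open>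
  \<open>f(\<rho>)\<close> for a density operator \<open>\<rho>\<close>. For \<open>f\<close> bounded on the unit interval the result does not
  depend on the decomposition selected.
\<close>

definition op_fun :: "(real \<Rightarrow> real) \<Rightarrow> 'i oper \<Rightarrow> 'i oper" where
  "op_fun f \<rho> = (let (V, p) = (SOME (V, p). spectral_decomposition \<rho> V p)
     in op_conjugate V (op_diag (\<lambda>k. complex_of_real (f (p k)))))"

text \<open>
  \<open>- \<rho> log \<rho>\<close> is a positive operator, so its diagonal entries are nonnegative reals and its trace is
  a well-defined element of \<open>[0, \<infinity>]\<close>. At the eigenvalue \<open>0\<close> the function \<open>x log x\<close> has the value \<open>0\<close>.
\<close>

definition vn_entropy :: "'i oper \<Rightarrow> ennreal" where
  "vn_entropy \<rho> = (\<Sum>\<^sub>\<infinity>i. ennreal (Re (op_fun (\<lambda>x. - (x * ln x)) \<rho> i i)))"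


subsection \<open>Bosonic modes\<close>

definition annihilation :: "nat oper" where
  "annihilation = (\<lambda>m n. if n = Suc m then complex_of_real (sqrt (real n)) else 0)"

definition coherent_ket :: "complex \<Rightarrow> nat \<Rightarrow> complex" where
  "coherent_ket \<alpha> n = complex_of_real (exp (- (cmod \<alpha>)\<^sup>2 / 2) / sqrt (fact n)) * \<alpha> ^ n"

definition coherent_state :: "complex \<Rightarrow> nat oper" where
  "coherent_state \<alpha> = (\<lambda>m n. coherent_ket \<alpha> m * cnj (coherent_ket \<alpha> n))"

definition thermal_state :: "real \<Rightarrow> nat oper" where
  "thermal_state N = op_diag (\<lambda>n. complex_of_real (N ^ n / (N + 1) ^ (n + 1)))"

definition phase_unitary :: "real \<Rightarrow> nat oper" where
  "phase_unitary \<theta> = op_diag (\<lambda>n. exp (\<i> * complex_of_real \<theta> * of_nat n))"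

text \<open>
  The beamsplitter unitary \<open>U\<close> with \<open>U\<^sup>\<dagger> a U = \<surd>\<eta> a + \<surd>(1 - \<eta>) c\<close> and
  \<open>U\<^sup>\<dagger> c U = - \<surd>(1 - \<eta>) a + \<surd>\<eta> c\<close>, where \<open>a\<close>, \<open>c\<close> annihilate photons of the first and the second
  mode. It fixes the vacuum, hence
  \<open>U |n, m\<rangle> = (n! m!)\<^sup>-\<^sup>\<half> (\<surd>\<eta> a\<^sup>\<dagger> - \<surd>(1 - \<eta>) c\<^sup>\<dagger>)\<^sup>n (\<surd>(1 - \<eta>) a\<^sup>\<dagger> + \<surd>\<eta> c\<^sup>\<dagger>)\<^sup>m |0, 0\<rangle>\<close>.
  The product is homogeneous of degree \<open>n + m\<close>; its coefficient at \<open>(a\<^sup>\<dagger>)\<^sup>p (c\<^sup>\<dagger>)\<^sup>q\<close> is read off the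
  polynomial in \<open>x\<close> obtained by putting \<open>a\<^sup>\<dagger> = x\<close> and \<open>c\<^sup>\<dagger> = 1\<close>.
\<close>

definition beamsplitter_poly :: "real \<Rightarrow> nat \<Rightarrow> nat \<Rightarrow> real poly" where
  "beamsplitter_poly \<eta> n m = [:- sqrt (1 - \<eta>), sqrt \<eta>:] ^ n * [:sqrt \<eta>, sqrt (1 - \<eta>):] ^ m"

definition beamsplitter :: "real \<Rightarrow> (nat \<times> nat) oper" where
  "beamsplitter \<eta> = (\<lambda>(p, q) (n, m).
     if p + q = n + m
     then complex_of_real (sqrt (fact p * fact q / (fact n * fact m))
                           * coeff (beamsplitter_poly \<eta> n m) p)
     else 0)"

lemma infsum_single_support:
  fixes f :: "'i \<Rightarrow> complex"
  assumes "\<And>j. j \<noteq> i \<Longrightarrow> f j = 0"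
  shows "infsum f UNIV = f i"
proof -
  have "infsum f UNIV = infsum f {i}"
    by (rule infsum_cong_neutral) (use assms in auto)
  then show ?thesis by simp
qed

lemma beamsplitter_vacuum: "beamsplitter \<eta> (0, 0) (0, 0) = 1"
  by (simp add: beamsplitter_def beamsplitter_poly_def)

lemma op_mult_annihilation_fst_left:
  "op_mult (op_tensor annihilation op_id) U (p, q) j = complex_of_real (sqrt (real (Suc p))) * U (Suc p, q) j"
proof -
  have "op_mult (op_tensor annihilation op_id) U (p, q) j =
    (\<Sum>\<^sub>\<infinity>k. op_tensor annihilation op_id (p, q) k * U k j)"
    by (simp add: op_mult_def)
  also have "\<dots> = op_tensor annihilation op_id (p, q) (Suc p, q) * U (Suc p, q) j"
    by (subst infsum_single_support[of "(Suc p, q)"])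
      (auto simp: op_tensor_def annihilation_def op_id_def op_diag_def split: prod.splits)
  finally show ?thesis
    by (simp add: op_tensor_def annihilation_def op_id_def op_diag_def)
qed

lemma op_mult_annihilation_snd_left:
  "op_mult (op_tensor op_id annihilation) U (p, q) j = complex_of_real (sqrt (real (Suc q))) * U (p, Suc q) j"
proof -
  have "op_mult (op_tensor op_id annihilation) U (p, q) j =
    (\<Sum>\<^sub>\<infinity>k. op_tensor op_id annihilation (p, q) k * U k j)"
    by (simp add: op_mult_def)
  also have "\<dots> = op_tensor op_id annihilation (p, q) (p, Suc q) * U (p, Suc q) j"
    by (subst infsum_single_support[of "(p, Suc q)"])
      (auto simp: op_tensor_def annihilation_def op_id_def op_diag_def split: prod.splits)
  finally show ?thesis
    by (simp add: op_tensor_def annihilation_def op_id_def op_diag_def)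
qed

lemma op_mult_annihilation_fst_right:
  "op_mult U (op_tensor annihilation op_id) i (n, m) = complex_of_real (sqrt (real n)) * U i (n - 1, m)"
proof -
  have "op_mult U (op_tensor annihilation op_id) i (n, m) =
    (\<Sum>\<^sub>\<infinity>k. U i k * op_tensor annihilation op_id k (n, m))"
    by (simp add: op_mult_def)
  also have "\<dots> = U i (n - 1, m) * op_tensor annihilation op_id (n - 1, m) (n, m)"
    by (subst infsum_single_support[of "(n - 1, m)"])
      (auto simp: op_tensor_def annihilation_def op_id_def op_diag_def split: prod.splits)
  finally show ?thesis
    by (cases n) (simp_all add: op_tensor_def annihilation_def op_id_def op_diag_def)
qed

lemma op_mult_annihilation_snd_right:
  "op_mult U (op_tensor op_id annihilation) i (n, m) = complex_of_real (sqrt (real m)) * U i (n, m - 1)"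
proof -
  have "op_mult U (op_tensor op_id annihilation) i (n, m) =
    (\<Sum>\<^sub>\<infinity>k. U i k * op_tensor op_id annihilation k (n, m))"
    by (simp add: op_mult_def)
  also have "\<dots> = U i (n, m - 1) * op_tensor op_id annihilation (n, m - 1) (n, m)"
    by (subst infsum_single_support[of "(n, m - 1)"])
      (auto simp: op_tensor_def annihilation_def op_id_def op_diag_def split: prod.splits)
  finally show ?thesis
    by (cases m) (simp_all add: op_tensor_def annihilation_def op_id_def op_diag_def)
qed

lemma pderiv_beamsplitter_poly:
  "pderiv (beamsplitter_poly \<eta> n m) =
     smult (real n * sqrt \<eta>) (beamsplitter_poly \<eta> (n - 1) m)
     + smult (real m * sqrt (1 - \<eta>)) (beamsplitter_poly \<eta> n (m - 1))"
proof -
  have "pderiv ([:a, b:] ^ k) = smult (real k * b) ([:a, b:] ^ (k - 1))" for a b :: real and k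
    by (cases k) (simp_all add: pderiv_power_Suc pderiv_pCons mult.commute del: power_Suc)
  then show ?thesis
    unfolding beamsplitter_poly_def
    by (simp add: pderiv_mult algebra_simps)
qed

lemma euler_beamsplitter_poly:
  "smult (real (n + m)) (beamsplitter_poly \<eta> n m) - pCons 0 (pderiv (beamsplitter_poly \<eta> n m)) =
     smult (- (real n * sqrt (1 - \<eta>))) (beamsplitter_poly \<eta> (n - 1) m)
     + smult (real m * sqrt \<eta>) (beamsplitter_poly \<eta> n (m - 1))"
proof -
  define L M where "L = [:- sqrt (1 - \<eta>), sqrt \<eta>:]" and "M = [:sqrt \<eta>, sqrt (1 - \<eta>):]"
  have L: "smult (real n) (L ^ n) = smult (real n) (L * L ^ (n - 1))" by (cases n) simp_all
  have M: "smult (real m) (M ^ m) = smult (real m) (M * M ^ (m - 1))" by (cases m) simp_all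
  have LX: "L - [:0, sqrt \<eta>:] = [:- sqrt (1 - \<eta>):]" and MX: "M - [:0, sqrt (1 - \<eta>):] = [:sqrt \<eta>:]"
    by (simp_all add: L_def M_def)
  have "smult (real (n + m)) (L ^ n * M ^ m) =
      smult (real n) (L ^ n) * M ^ m + L ^ n * smult (real m) (M ^ m)"
    by (simp add: smult_add_left)
  also have "\<dots> = smult (real n) (L ^ (n - 1) * M ^ m) * L + smult (real m) (L ^ n * M ^ (m - 1)) * M"
    unfolding L M by (simp add: algebra_simps)
  finally have 1: "smult (real (n + m)) (L ^ n * M ^ m) = \<dots>" .
  have 2: "pCons 0 (pderiv (L ^ n * M ^ m)) =
      smult (real n) (L ^ (n - 1) * M ^ m) * [:0, sqrt \<eta>:]
      + smult (real m) (L ^ n * M ^ (m - 1)) * [:0, sqrt (1 - \<eta>):]"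
    using pderiv_beamsplitter_poly[of \<eta> n m]
    unfolding beamsplitter_poly_def L_def[symmetric] M_def[symmetric]
    by (simp add: smult_add_right mult.commute)
  have "smult (real (n + m)) (L ^ n * M ^ m) - pCons 0 (pderiv (L ^ n * M ^ m)) =
      smult (real n) (L ^ (n - 1) * M ^ m) * (L - [:0, sqrt \<eta>:])
      + smult (real m) (L ^ n * M ^ (m - 1)) * (M - [:0, sqrt (1 - \<eta>):])"
    unfolding 1 2 by (simp only: algebra_simps)
  then show ?thesis
    unfolding LX MX unfolding beamsplitter_poly_def L_def[symmetric] M_def[symmetric]
    by (simp add: mult.commute)
qed

lemma sqrt_mult_fact: "sqrt (real (Suc k)) * sqrt (fact (Suc k)) = real (Suc k) * sqrt (fact k)"
  by (simp add: real_sqrt_mult flip: mult.assoc)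

lemma sqrt_div_fact: "sqrt (real n) / sqrt (fact (n - 1)) = real n / sqrt (fact n)"
proof (cases n)
  case (Suc k)
  have "real (Suc k) = sqrt (real (Suc k)) * sqrt (real (Suc k))" by simp
  then show ?thesis using Suc
    by (simp add: real_sqrt_mult divide_simps)
qed simp

text \<open>
  The relations for \<open>U\<^sup>\<dagger> a U\<close> and \<open>U\<^sup>\<dagger> c U\<close> above, multiplied by \<open>U\<close> from the left.
\<close>

theorem beamsplitter_fst:
  "op_mult (op_tensor annihilation op_id) (beamsplitter \<eta>) i j =
     complex_of_real (sqrt \<eta>) * op_mult (beamsplitter \<eta>) (op_tensor annihilation op_id) i j
     + complex_of_real (sqrt (1 - \<eta>)) * op_mult (beamsplitter \<eta>) (op_tensor op_id annihilation) i j"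
proof -
  obtain p q n m where ij: "i = (p, q)" "j = (n, m)" by fastforce
  define c where "c n m = coeff (beamsplitter_poly \<eta> n m) p" for n m
  have c: "real (Suc p) * coeff (beamsplitter_poly \<eta> n m) (Suc p) =
      real n * sqrt \<eta> * c (n - 1) m + real m * sqrt (1 - \<eta>) * c n (m - 1)"
    using arg_cong[OF pderiv_beamsplitter_poly[of \<eta> n m], of "\<lambda>f. coeff f p"]
    by (simp add: coeff_pderiv c_def)
  show ?thesis
  proof (cases "Suc p + q = n + m")
    case True
    have "sqrt (real (Suc p)) * sqrt (fact (Suc p) * fact q / (fact n * fact m))
          * coeff (beamsplitter_poly \<eta> n m) (Suc p)
        = (sqrt (real (Suc p)) * sqrt (fact (Suc p))) * sqrt (fact q)
          / (sqrt (fact n) * sqrt (fact m)) * coeff (beamsplitter_poly \<eta> n m) (Suc p)"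
      by (simp add: real_sqrt_mult real_sqrt_divide del: fact_Suc of_nat_Suc)
    also have "\<dots> = sqrt (fact p) * sqrt (fact q) / (sqrt (fact n) * sqrt (fact m))
          * (real (Suc p) * coeff (beamsplitter_poly \<eta> n m) (Suc p))"
      unfolding sqrt_mult_fact by (simp del: of_nat_Suc)
    also have "\<dots> = sqrt (fact p) * sqrt (fact q) * sqrt \<eta> * c (n - 1) m
            * (real n / sqrt (fact n)) / sqrt (fact m)
          + sqrt (fact p) * sqrt (fact q) * sqrt (1 - \<eta>) * c n (m - 1)
            * (real m / sqrt (fact m)) / sqrt (fact n)"
      unfolding c by (simp add: field_simps)
    also have "\<dots> = sqrt \<eta> * (sqrt (real n)
            * (sqrt (fact p * fact q / (fact (n - 1) * fact m)) * c (n - 1) m))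
          + sqrt (1 - \<eta>) * (sqrt (real m)
            * (sqrt (fact p * fact q / (fact n * fact (m - 1))) * c n (m - 1)))"
      unfolding sqrt_div_fact[symmetric] by (simp add: real_sqrt_mult real_sqrt_divide field_simps)
    finally have eq: "sqrt (real (Suc p)) * (sqrt (fact (Suc p) * fact q / (fact n * fact m))
          * coeff (beamsplitter_poly \<eta> n m) (Suc p)) = \<dots>"
      by (simp only: mult.assoc)
    have "of_real (sqrt (real (Suc p))) * beamsplitter \<eta> (Suc p, q) (n, m) =
      of_real (sqrt (real (Suc p)) * (sqrt (fact (Suc p) * fact q / (fact n * fact m))
          * coeff (beamsplitter_poly \<eta> n m) (Suc p)))"
      using True by (simp add: beamsplitter_def c_def del: of_nat_Suc fact_Suc)
    moreover have "of_real (sqrt (real n)) * beamsplitter \<eta> (p, q) (n - 1, m) =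
      of_real (sqrt (real n) * (sqrt (fact p * fact q / (fact (n - 1) * fact m)) * c (n - 1) m))"
      using True by (cases n) (simp_all add: beamsplitter_def c_def del: of_nat_Suc fact_Suc)
    moreover have "of_real (sqrt (real m)) * beamsplitter \<eta> (p, q) (n, m - 1) =
      of_real (sqrt (real m) * (sqrt (fact p * fact q / (fact n * fact (m - 1))) * c n (m - 1)))"
      using True by (cases m) (simp_all add: beamsplitter_def c_def del: of_nat_Suc fact_Suc)
    ultimately show ?thesis
      unfolding ij unfolding op_mult_annihilation_fst_left op_mult_annihilation_fst_right
        op_mult_annihilation_snd_right
      by (simp only: eq minus_mult_left of_real_mult [symmetric] of_real_add [symmetric] of_real_minus [symmetric])
  next
    case False
    then have "n = 0 \<or> p + q \<noteq> n - 1 + m" "m = 0 \<or> p + q \<noteq> n + (m - 1)" by auto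
    then show ?thesis
      unfolding ij unfolding op_mult_annihilation_fst_left op_mult_annihilation_fst_right
        op_mult_annihilation_snd_right
      using False by (auto simp: beamsplitter_def)
  qed
qed

theorem beamsplitter_snd:
  "op_mult (op_tensor op_id annihilation) (beamsplitter \<eta>) i j =
     - complex_of_real (sqrt (1 - \<eta>)) * op_mult (beamsplitter \<eta>) (op_tensor annihilation op_id) i j
     + complex_of_real (sqrt \<eta>) * op_mult (beamsplitter \<eta>) (op_tensor op_id annihilation) i j"
proof -
  obtain p q n m where ij: "i = (p, q)" "j = (n, m)" by fastforce
  define c where "c n m = coeff (beamsplitter_poly \<eta> n m) p" for n m
  have c: "real (n + m) * c n m - real p * c n m =
      - (real n * sqrt (1 - \<eta>) * c (n - 1) m) + real m * sqrt \<eta> * c n (m - 1)"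
    using arg_cong[OF euler_beamsplitter_poly[of n m \<eta>], of "\<lambda>f. coeff f p"]
    by (cases p) (simp_all add: coeff_pderiv c_def)
  show ?thesis
  proof (cases "p + Suc q = n + m")
    case True
    then have "real (n + m) - real p = real (Suc q)" by linarith
    with c have c': "real (Suc q) * c n m =
      - (real n * sqrt (1 - \<eta>) * c (n - 1) m) + real m * sqrt \<eta> * c n (m - 1)"
      by (metis left_diff_distrib)
    have "sqrt (real (Suc q)) * sqrt (fact p * fact (Suc q) / (fact n * fact m)) * c n m
        = (sqrt (real (Suc q)) * sqrt (fact (Suc q))) * sqrt (fact p)
          / (sqrt (fact n) * sqrt (fact m)) * c n m"
      by (simp add: real_sqrt_mult real_sqrt_divide del: fact_Suc of_nat_Suc)
    also have "\<dots> = sqrt (fact p) * sqrt (fact q) / (sqrt (fact n) * sqrt (fact m))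
          * (real (Suc q) * c n m)"
      unfolding sqrt_mult_fact by (simp del: of_nat_Suc)
    also have "\<dots> = - (sqrt (fact p) * sqrt (fact q) * sqrt (1 - \<eta>) * c (n - 1) m
            * (real n / sqrt (fact n)) / sqrt (fact m))
          + sqrt (fact p) * sqrt (fact q) * sqrt \<eta> * c n (m - 1)
            * (real m / sqrt (fact m)) / sqrt (fact n)"
      unfolding c' by (simp add: field_simps)
    also have "\<dots> = - sqrt (1 - \<eta>) * (sqrt (real n)
            * (sqrt (fact p * fact q / (fact (n - 1) * fact m)) * c (n - 1) m))
          + sqrt \<eta> * (sqrt (real m)
            * (sqrt (fact p * fact q / (fact n * fact (m - 1))) * c n (m - 1)))"
      unfolding sqrt_div_fact[symmetric] by (simp add: real_sqrt_mult real_sqrt_divide field_simps)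
    finally have eq: "sqrt (real (Suc q)) * (sqrt (fact p * fact (Suc q) / (fact n * fact m))
          * c n m) = \<dots>"
      by (simp only: mult.assoc)
    have "of_real (sqrt (real (Suc q))) * beamsplitter \<eta> (p, Suc q) (n, m) =
      of_real (sqrt (real (Suc q)) * (sqrt (fact p * fact (Suc q) / (fact n * fact m)) * c n m))"
      using True by (simp add: beamsplitter_def c_def del: of_nat_Suc fact_Suc)
    moreover have "of_real (sqrt (real n)) * beamsplitter \<eta> (p, q) (n - 1, m) =
      of_real (sqrt (real n) * (sqrt (fact p * fact q / (fact (n - 1) * fact m)) * c (n - 1) m))"
      using True by (cases n) (simp_all add: beamsplitter_def c_def del: of_nat_Suc fact_Suc)
    moreover have "of_real (sqrt (real m)) * beamsplitter \<eta> (p, q) (n, m - 1) =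
      of_real (sqrt (real m) * (sqrt (fact p * fact q / (fact n * fact (m - 1))) * c n (m - 1)))"
      using True by (cases m) (simp_all add: beamsplitter_def c_def del: of_nat_Suc fact_Suc)
    ultimately show ?thesis
      unfolding ij unfolding op_mult_annihilation_snd_left op_mult_annihilation_fst_right
        op_mult_annihilation_snd_right
      by (simp only: eq minus_mult_left of_real_mult [symmetric] of_real_add [symmetric] of_real_minus [symmetric])
  next
    case False
    then have "n = 0 \<or> p + q \<noteq> n - 1 + m" "m = 0 \<or> p + q \<noteq> n + (m - 1)" by auto
    then show ?thesis
      unfolding ij unfolding op_mult_annihilation_snd_left op_mult_annihilation_fst_right
        op_mult_annihilation_snd_right
      using False by (auto simp: beamsplitter_def)
  qed
qed

definition bosonic_channel :: "real \<Rightarrow> real \<Rightarrow> nat oper \<Rightarrow> nat oper" where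
  "bosonic_channel \<eta> N\<^sub>B \<rho> =
     partial_trace_snd (op_conjugate (beamsplitter \<eta>) (op_tensor \<rho> (thermal_state N\<^sub>B)))"


subsection \<open>Holevo information of the ring state\<close>

text \<open>Two-mode operators have the signal (later: output) mode first and the idler mode second.\<close>

definition split_coherent_state :: "real \<Rightarrow> complex \<Rightarrow> (nat \<times> nat) oper" where
  "split_coherent_state \<tau> \<alpha> =
     op_tensor (coherent_state (complex_of_real (sqrt \<tau>) * \<alpha>))
               (coherent_state (complex_of_real (sqrt (1 - \<tau>)) * \<alpha>))"

definition output_state :: "real \<Rightarrow> real \<Rightarrow> (nat \<times> nat) oper \<Rightarrow> real \<Rightarrow> (nat \<times> nat) oper" where
  "output_state \<eta> N\<^sub>B \<rho>\<^sub>S\<^sub>I \<theta> =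
     map_tensor_id (bosonic_channel \<eta> N\<^sub>B)
       (map_tensor_id (op_conjugate (phase_unitary \<theta>)) \<rho>\<^sub>S\<^sub>I)"

definition ring_average :: "real \<Rightarrow> real \<Rightarrow> (nat \<times> nat) oper \<Rightarrow> (nat \<times> nat) oper" where
  "ring_average \<eta> N\<^sub>B \<rho>\<^sub>S\<^sub>I = (\<lambda>i j.
     (LBINT \<theta>:{0..2*pi}. output_state \<eta> N\<^sub>B \<rho>\<^sub>S\<^sub>I \<theta> i j) / complex_of_real (2*pi))"

text \<open>
  The entropies of the split coherent resource are finite, so no \<open>\<infinity> - \<infinity>\<close> arises for it below.
\<close>

definition holevo_ring :: "real \<Rightarrow> real \<Rightarrow> (nat \<times> nat) oper \<Rightarrow> ereal" where
  "holevo_ring \<eta> N\<^sub>B \<rho>\<^sub>S\<^sub>I =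
     enn2ereal (vn_entropy (ring_average \<eta> N\<^sub>B \<rho>\<^sub>S\<^sub>I))
     - enn2ereal ((\<integral>\<^sup>+\<theta>\<in>{0..2*pi}. vn_entropy (output_state \<eta> N\<^sub>B \<rho>\<^sub>S\<^sub>I \<theta>) \<partial>lborel)
                  / ennreal (2*pi))"

end

(*
  The channel maps the coherent state a to D(b) T D(b)^*, the thermal state T with mean photon number
  N_T displaced by b = sqrt(eta) a. Averaging over the phase of b removes the off-diagonal Fock entries,
  so the entropy gain is H(P) - H(T) for the photon number distribution P of the displaced thermal
  state, the idler staying pure. With S = |b|^2 = eta tau |alpha|^2 and x = S / (N_T (N_T + 1)),
    P(n) = N_T^n / (N_T + 1)^(n + 1) exp(- S / (N_T + 1)) L_n(- x),
  where the Laguerre factor satisfies L_n(- x) <= (1 + x)^n. Hence - ln P(n) is bounded below by an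
  affine function of n, and the claim follows from the mean of P, which is N_T + S.
*)

theory Submission imports Defs begin

subsection \<open>Infinite sums\<close>

text \<open>Operators are infinite matrices and their products are infinite sums, so rearranging
  operator expressions is never free. Operator identities are therefore verified entrywise by a
  ladder method: letting an annihilation operator act yields a recursion for the entries, both sides
  satisfy it, and they agree at the vacuum; dividing by \<open>sqrt (real (Suc n))\<close> then
  determines every entry. Unitarity of displacements, their passage through the beamsplitter and the
  closed form of the displaced thermal state are all obtained this way. The other obstacle is that
  \<open>vn_entropy\<close> evaluates a decomposition picked by \<open>SOME\<close>. Once the
  eigenvalue sum is known to be the same for every decomposition, explicit eigenbases suffice:
  displaced Fock states for the signal of each output state, the Fock basis for the signal of the
  average, and in both cases a displaced Fock basis for the idler.\<close>

lemma ennreal_summable_on [simp]: "(f :: 'a \<Rightarrow> ennreal) summable_on A"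
  by (rule nonneg_summable_on_complete) simp

lemma infsum_ennreal_cmult:
  fixes c :: ennreal
  shows "(\<Sum>\<^sub>\<infinity>k\<in>A. c * f k) = c * (\<Sum>\<^sub>\<infinity>k\<in>A. f k)"
proof -
  have "(\<Sum>\<^sub>\<infinity>k\<in>A. c * f k) = (SUP F\<in>{F. finite F \<and> F \<subseteq> A}. c * sum f F)"
    by (subst nonneg_infsum_complete) (simp_all add: sum_distrib_left)
  also have "\<dots> = c * (SUP F\<in>{F. finite F \<and> F \<subseteq> A}. sum f F)"
    by (subst SUP_mult_left_ennreal) auto
  also have "(SUP F\<in>{F. finite F \<and> F \<subseteq> A}. sum f F) = (\<Sum>\<^sub>\<infinity>k\<in>A. f k)"
    by (subst nonneg_infsum_complete) simp_all
  finally show ?thesis .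
qed

text \<open>One inequality suffices, since it also applies to the transposed family; hence
  \<open>le\<close> is stated for fresh index types. It holds because finite outer sums pass through
  the inner sum.\<close>

lemma infsum_ennreal_swap:
  fixes f :: "'a \<Rightarrow> 'b \<Rightarrow> ennreal"
  shows "(\<Sum>\<^sub>\<infinity>x\<in>A. \<Sum>\<^sub>\<infinity>y\<in>B. f x y) = (\<Sum>\<^sub>\<infinity>y\<in>B. \<Sum>\<^sub>\<infinity>x\<in>A. f x y)"
proof -
  have le: "(\<Sum>\<^sub>\<infinity>x\<in>A. \<Sum>\<^sub>\<infinity>y\<in>B. f x y) \<le> (\<Sum>\<^sub>\<infinity>y\<in>B. \<Sum>\<^sub>\<infinity>x\<in>A. f x y)"
    for f :: "'c \<Rightarrow> 'd \<Rightarrow> ennreal" and A B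
  proof (rule infsum_le_finite_sums)
    fix F assume F: "finite F" "F \<subseteq> A"
    have "(\<Sum>x\<in>F. \<Sum>\<^sub>\<infinity>y\<in>B. f x y) = (\<Sum>\<^sub>\<infinity>y\<in>B. \<Sum>x\<in>F. f x y)"
      using F(1)
    proof induction
      case (insert x F)
      then show ?case
        by (simp add: infsum_add)
    qed simp
    also have "\<dots> \<le> (\<Sum>\<^sub>\<infinity>y\<in>B. \<Sum>\<^sub>\<infinity>x\<in>A. f x y)"
    proof (intro infsum_mono ennreal_summable_on)
      fix y
      have "(\<Sum>x\<in>F. f x y) = (\<Sum>\<^sub>\<infinity>x\<in>F. f x y)" using F by simp
      also have "\<dots> \<le> (\<Sum>\<^sub>\<infinity>x\<in>A. f x y)"
        by (rule infsum_mono_neutral) (use F in auto)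
      finally show "(\<Sum>x\<in>F. f x y) \<le> (\<Sum>\<^sub>\<infinity>x\<in>A. f x y)" .
    qed
    finally show "(\<Sum>x\<in>F. \<Sum>\<^sub>\<infinity>y\<in>B. f x y) \<le> (\<Sum>\<^sub>\<infinity>y\<in>B. \<Sum>\<^sub>\<infinity>x\<in>A. f x y)" .
  qed simp
  show ?thesis by (intro antisym le)
qed

lemma infsum_ennreal_of_real:
  assumes "f summable_on A" "\<And>x. x \<in> A \<Longrightarrow> 0 \<le> f x"
  shows "(\<Sum>\<^sub>\<infinity>x\<in>A. ennreal (f x)) = ennreal (\<Sum>\<^sub>\<infinity>x\<in>A. f x)"
proof -
  have "(\<Sum>\<^sub>\<infinity>x\<in>A. ennreal (f x)) = (SUP F\<in>{F. finite F \<and> F \<subseteq> A}. ennreal (sum f F))"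
    by (subst nonneg_infsum_complete, simp) (intro SUP_cong refl sum_ennreal, use assms in auto)
  then show ?thesis using infsum_nonneg_is_SUPREMUM_ennreal[OF assms] by simp
qed

section \<open>Absolutely and square summable families, exchange of sums\<close>

abbreviation l1 :: "('i \<Rightarrow> complex) \<Rightarrow> bool" where
  "l1 x \<equiv> (\<lambda>k. cmod (x k)) summable_on UNIV"

abbreviation l2 :: "('i \<Rightarrow> complex) \<Rightarrow> bool" where
  "l2 x \<equiv> (\<lambda>k. (cmod (x k))\<^sup>2) summable_on UNIV"

text \<open>Fubini in the shape needed later: summable weights and rows with a common l1 bound make
  the double family absolutely summable. The weights will be eigenvalues or thermal weights.\<close>

lemma infsum_swap_weighted:
  fixes a :: "'a \<Rightarrow> complex" and X :: "'a \<Rightarrow> 'b \<Rightarrow> complex"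
  assumes a: "l1 a" and X: "\<And>k. l1 (X k)"
    and C: "\<And>k. (\<Sum>\<^sub>\<infinity>n. cmod (X k n)) \<le> C"
  shows "(\<Sum>\<^sub>\<infinity>n. \<Sum>\<^sub>\<infinity>k. a k * X k n) = (\<Sum>\<^sub>\<infinity>k. a k * (\<Sum>\<^sub>\<infinity>n. X k n))"
proof -
  have *: "(\<lambda>x. norm (case x of (k, n) \<Rightarrow> a k * X k n)) summable_on UNIV \<times> UNIV"
    unfolding Infinite_Sum.abs_summable_on_Sigma_iff
  proof (intro conjI ballI)
    show "(\<lambda>y. norm (case (k, y) of (k, n) \<Rightarrow> a k * X k n)) summable_on UNIV" for k
      using X[of k] by (simp add: norm_mult summable_on_cmult_right)
    have "(\<lambda>k. cmod (a k) * (\<Sum>\<^sub>\<infinity>n. cmod (X k n))) summable_on UNIV"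
    proof (rule summable_on_comparison_test)
      show "(\<lambda>k. cmod (a k) * C) summable_on UNIV"
        using a by (rule summable_on_cmult_left)
      show "0 \<le> cmod (a k) * (\<Sum>\<^sub>\<infinity>n. cmod (X k n))" for k
        by (simp add: infsum_nonneg)
    qed (use C in \<open>auto intro: mult_left_mono\<close>)
    then show "(\<lambda>k. norm (\<Sum>\<^sub>\<infinity>n. norm (case (k, n) of (k, n) \<Rightarrow> a k * X k n))) summable_on UNIV"
      by (simp add: norm_mult infsum_cmult_right' abs_mult infsum_nonneg)
  qed
  then have "(\<lambda>(k, n). a k * X k n) summable_on UNIV \<times> UNIV"
    by (rule abs_summable_summable)
  from infsum_swap_banach[OF this] show ?thesis
    by (simp add: infsum_cmult_right')
qed

text \<open>Used to carry total mass and mean photon number from the displaced number states to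
  their thermal mixture.\<close>

lemma has_sum_Tonelli:
  fixes f :: "'a \<Rightarrow> 'b \<Rightarrow> real"
  assumes f: "\<And>x. (f x has_sum g x) UNIV" and g: "(g has_sum s) UNIV" and nn: "\<And>x y. 0 \<le> f x y"
  shows "(\<lambda>x. f x y) summable_on UNIV" and "((\<lambda>y. \<Sum>\<^sub>\<infinity>x. f x y) has_sum s) UNIV"
proof -
  have "(\<lambda>(x, y). f x y) summable_on UNIV \<times> UNIV"
    by (rule summable_on_SigmaI[where g = g]) (use f g nn has_sum_imp_summable in auto)
  then have "((\<lambda>(x, y). f x y) has_sum s) (UNIV \<times> UNIV)"
    by (intro has_sum_SigmaI[where g = g]) (use f g in auto)
  then have *: "((\<lambda>(y, x). f x y) has_sum s) (UNIV \<times> UNIV)"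
    by (subst (asm) has_sum_swap) simp
  show y: "(\<lambda>x. f x y) summable_on UNIV" for y
    using summable_on_SigmaD1[of "\<lambda>y x. f x y" UNIV "\<lambda>_. UNIV" y] has_sum_imp_summable[OF *] by simp
  show "((\<lambda>y. \<Sum>\<^sub>\<infinity>x. f x y) has_sum s) UNIV"
    by (rule has_sum_SigmaD[OF *]) (use y in auto)
qed

lemma infsum_prod:
  fixes f :: "'a \<Rightarrow> complex" and g :: "'b \<Rightarrow> complex"
  assumes f: "l1 f" and g: "l1 g"
  shows "(\<Sum>\<^sub>\<infinity>(x, y). f x * g y) = infsum f UNIV * infsum g UNIV"
proof -
  have *: "(\<lambda>z. norm (case z of (x, y) \<Rightarrow> f x * g y)) summable_on UNIV \<times> UNIV"
    unfolding Infinite_Sum.abs_summable_on_Sigma_iff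
    using f g by (auto simp: norm_mult abs_mult infsum_cmult_right' infsum_nonneg
        intro!: summable_on_cmult_right summable_on_cmult_left)
  then have "(\<lambda>(x, y). f x * g y) summable_on UNIV \<times> UNIV" by (rule abs_summable_summable)
  from infsum_Sigma_banach[OF this] show ?thesis
    by (simp add: infsum_cmult_right' infsum_cmult_left')
qed

text \<open>In its uses the term at 0 vanishes because of a ladder factor
  \<open>sqrt (real m)\<close>; the shift moves a ladder operator across the sum.\<close>

lemma infsum_Suc:
  fixes f :: "nat \<Rightarrow> 'a::{comm_monoid_add, t2_space}"
  assumes "f 0 = 0"
  shows "(\<Sum>\<^sub>\<infinity>m. f m) = (\<Sum>\<^sub>\<infinity>m. f (Suc m))"
proof -
  have "(\<Sum>\<^sub>\<infinity>m. f m) = (\<Sum>\<^sub>\<infinity>m\<in>range Suc. f m)"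
  proof (rule infsum_cong_neutral)
    show "f x = 0" if "x \<in> UNIV - range Suc" for x
      using that assms by (cases x) auto
  qed auto
  also have "\<dots> = (\<Sum>\<^sub>\<infinity>m. f (Suc m))"
    by (subst infsum_reindex) (auto simp: o_def)
  finally show ?thesis .
qed

lemma mult_le_sum_squares: "(a::real) * b \<le> a\<^sup>2 + b\<^sup>2"
proof -
  have "0 \<le> (a - b)\<^sup>2 + a\<^sup>2 + b\<^sup>2" by simp
  then show ?thesis by (simp add: power2_diff)
qed

lemma l2_mult_abs_summable:
  assumes "l2 x" "l2 y"
  shows "l1 (\<lambda>k. x k * y k)"
  using summable_on_add[OF assms]
  by (rule Infinite_Sum.abs_summable_on_comparison_test') (auto simp: norm_mult intro: mult_le_sum_squares)

text \<open>A crude substitute for Cauchy-Schwarz: only a bound uniform in a parameter is wanted, as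
  input to \<open>infsum_swap_weighted\<close>.\<close>

lemma l2_mult_bound:
  assumes "l2 x" "l2 y"
  shows "(\<Sum>\<^sub>\<infinity>k. cmod (x k * y k)) \<le> (\<Sum>\<^sub>\<infinity>k. (cmod (x k))\<^sup>2) + (\<Sum>\<^sub>\<infinity>k. (cmod (y k))\<^sup>2)"
  unfolding infsum_add[OF assms, symmetric]
  by (rule infsum_mono[OF l2_mult_abs_summable[OF assms] summable_on_add[OF assms]])
    (auto simp: norm_mult intro: mult_le_sum_squares)

lemma l2_cnj: "l2 x \<Longrightarrow> l2 (\<lambda>k. cnj (x k))"
  by simp

lemma l2_cmult: "l2 x \<Longrightarrow> l2 (\<lambda>k. c * x k)"
  by (simp add: norm_mult power_mult_distrib summable_on_cmult_right)

lemma l2_add: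
  assumes "l2 x" "l2 y"
  shows "l2 (\<lambda>k. x k + y k)"
proof (rule summable_on_comparison_test)
  show "(\<lambda>k. 2 * ((cmod (x k))\<^sup>2 + (cmod (y k))\<^sup>2)) summable_on UNIV"
    by (intro summable_on_cmult_right summable_on_add assms)
  show "(cmod (x k + y k))\<^sup>2 \<le> 2 * ((cmod (x k))\<^sup>2 + (cmod (y k))\<^sup>2)" for k
  proof -
    have "(cmod (x k + y k))\<^sup>2 \<le> (cmod (x k) + cmod (y k))\<^sup>2"
      by (intro power_mono norm_triangle_ineq) simp
    also have "\<dots> \<le> 2 * ((cmod (x k))\<^sup>2 + (cmod (y k))\<^sup>2)"
      using sum_squares_bound[of "cmod (x k)" "cmod (y k)"] by (simp add: power2_sum)
    finally show ?thesis .
  qed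
qed simp

text \<open>\<open>infsum\<close> is 0 on families that are not summable, so the value 1 already
  certifies summability. This is how the equations in \<open>unitary_op\<close> yield square
  summable rows and columns.\<close>

lemma infsum_cmod_square:
  "(\<Sum>\<^sub>\<infinity>k. cnj (x k) * x k) = 1 \<longleftrightarrow> ((\<lambda>k. (cmod (x k))\<^sup>2) has_sum 1) UNIV"
proof -
  have eq: "(\<lambda>k. cnj (x k) * x k) = (\<lambda>k. complex_of_real ((cmod (x k))\<^sup>2))"
    by (simp add: fun_eq_iff complex_norm_square mult.commute del: of_real_power)
  have "(\<Sum>\<^sub>\<infinity>k. cnj (x k) * x k) = 1 \<longleftrightarrow> ((\<lambda>k. complex_of_real ((cmod (x k))\<^sup>2)) has_sum of_real 1) UNIV"
    unfolding eq by (metis has_sum_infsum infsumI infsum_not_exists of_real_1 zero_neq_one)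
  then show ?thesis unfolding has_sum_of_real_iff .
qed

subsection \<open>Spectral decompositions and entropy\<close>

lemma op_conjugate_diag:
  "op_conjugate V (op_diag d) i j = (\<Sum>\<^sub>\<infinity>k. V i k * d k * cnj (V j k))"
proof -
  have "op_mult (op_diag d) (op_adj V) k j = d k * cnj (V j k)" for k
    unfolding op_mult_def op_diag_def op_adj_def
    by (subst infsum_single_support[of k]) auto
  then show ?thesis
    unfolding op_conjugate_def op_mult_def[of V] by (simp add: mult.assoc)
qed

lemma unitary_op_columns:
  assumes "unitary_op V"
  shows "(\<Sum>\<^sub>\<infinity>m. cnj (V m i) * V m j) = (if i = j then 1 else 0)"
proof -
  have "op_mult (op_adj V) V i j = op_id i j" using assms by (simp add: unitary_op_def)
  then show ?thesis by (simp add: op_mult_def op_adj_def op_id_def op_diag_def)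
qed

lemma unitary_op_rows:
  assumes "unitary_op V"
  shows "(\<Sum>\<^sub>\<infinity>m. V i m * cnj (V j m)) = (if i = j then 1 else 0)"
proof -
  have "op_mult V (op_adj V) i j = op_id i j" using assms by (simp add: unitary_op_def)
  then show ?thesis by (simp add: op_mult_def op_adj_def op_id_def op_diag_def)
qed

lemma unitary_op_column_norm:
  "unitary_op V \<Longrightarrow> ((\<lambda>m. (cmod (V m k))\<^sup>2) has_sum 1) UNIV"
  using unitary_op_columns[of V k k] by (simp flip: infsum_cmod_square)

lemma unitary_op_row_norm:
  "unitary_op V \<Longrightarrow> ((\<lambda>m. (cmod (V k m))\<^sup>2) has_sum 1) UNIV"
  using unitary_op_rows[of V k k] infsum_cmod_square[of "V k"] by (simp add: mult.commute)

lemma unitary_op_entry_le_1: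
  assumes "unitary_op V"
  shows "cmod (V i j) \<le> 1"
proof -
  have "(\<Sum>m\<in>{i}. (cmod (V m j))\<^sup>2) \<le> 1"
    by (rule finite_sum_le_has_sum[OF unitary_op_column_norm[OF assms]]) auto
  then show ?thesis by (simp add: power_le_one_iff)
qed

text \<open>The form \<open><u, \<rho> w>\<close> expanded in the eigenbasis. Both exchanges of sums
  take the eigenvalues as weights; the bounds are uniform in k because columns of \<open>V\<close>
  have norm 1 and entries have modulus at most 1.\<close>

lemma spectral_form:
  assumes V: "unitary_op V" and p: "p summable_on UNIV" "\<And>k. 0 \<le> p k"
    and u: "l2 u" and w: "l2 w"
  defines "\<rho> \<equiv> op_conjugate V (op_diag (\<lambda>k. complex_of_real (p k)))"
  shows "(\<Sum>\<^sub>\<infinity>m. cnj (u m) * (\<Sum>\<^sub>\<infinity>n. \<rho> m n * w n)) =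
    (\<Sum>\<^sub>\<infinity>k. of_real (p k) * (\<Sum>\<^sub>\<infinity>m. cnj (u m) * V m k) * (\<Sum>\<^sub>\<infinity>n. cnj (V n k) * w n))"
proof -
  define b where "b k = (\<Sum>\<^sub>\<infinity>n. cnj (V n k) * w n)" for k
  have V2: "l2 (\<lambda>n. V n k)" "(\<Sum>\<^sub>\<infinity>n. (cmod (V n k))\<^sup>2) = 1" for k
    using unitary_op_column_norm[OF V] by (auto intro: has_sum_imp_summable infsumI)
  have Vw: "l1 (\<lambda>n. cnj (V n k) * w n)" for k
    by (intro l2_mult_abs_summable l2_cnj V2 w)
  have Vw': "(\<Sum>\<^sub>\<infinity>n. cmod (cnj (V n k) * w n)) \<le> 1 + (\<Sum>\<^sub>\<infinity>n. (cmod (w n))\<^sup>2)" for k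
    using l2_mult_bound[OF l2_cnj[OF V2(1)[of k]] w] V2(2) by simp
  have b: "cmod (b k) \<le> 1 + (\<Sum>\<^sub>\<infinity>n. (cmod (w n))\<^sup>2)" for k
    using norm_infsum_bound[OF Vw[of k]] Vw'[of k] by (simp add: b_def)
  have uV: "l1 (\<lambda>n. cnj (u n) * V n k)" for k
    by (intro l2_mult_abs_summable l2_cnj V2 u)
  have uV': "(\<Sum>\<^sub>\<infinity>n. cmod (cnj (u n) * V n k)) \<le> (\<Sum>\<^sub>\<infinity>n. (cmod (u n))\<^sup>2) + 1" for k
    using l2_mult_bound[OF l2_cnj[OF u] V2(1)[of k]] V2(2) by simp
  have pc: "l1 (\<lambda>k. complex_of_real (p k))" using p by simp
  have 1: "(\<Sum>\<^sub>\<infinity>n. \<rho> m n * w n) = (\<Sum>\<^sub>\<infinity>k. of_real (p k) * (V m k * b k))" for m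
  proof -
    have "(\<Sum>\<^sub>\<infinity>n. \<rho> m n * w n) = (\<Sum>\<^sub>\<infinity>n. \<Sum>\<^sub>\<infinity>k. of_real (p k) * (V m k * (cnj (V n k) * w n)))"
      unfolding \<rho>_def op_conjugate_diag infsum_cmult_left'[symmetric] by (simp add: algebra_simps)
    also have "\<dots> = (\<Sum>\<^sub>\<infinity>k. of_real (p k) * (\<Sum>\<^sub>\<infinity>n. V m k * (cnj (V n k) * w n)))"
    proof (rule infsum_swap_weighted[OF pc, where C = "1 + (\<Sum>\<^sub>\<infinity>n. (cmod (w n))\<^sup>2)"])
      show "l1 (\<lambda>n. V m k * (cnj (V n k) * w n))" for k
        using Vw[of k] by (subst norm_mult) (rule summable_on_cmult_right)
      have "cmod (V m k) * (\<Sum>\<^sub>\<infinity>n. cmod (cnj (V n k) * w n)) \<le> 1 * (1 + (\<Sum>\<^sub>\<infinity>n. (cmod (w n))\<^sup>2))" for k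
        by (intro mult_mono unitary_op_entry_le_1 V Vw') (auto intro: infsum_nonneg)
      then show "(\<Sum>\<^sub>\<infinity>n. cmod (V m k * (cnj (V n k) * w n))) \<le> 1 + (\<Sum>\<^sub>\<infinity>n. (cmod (w n))\<^sup>2)" for k
        by (subst norm_mult) (simp only: infsum_cmult_right' mult_1)
    qed
    finally show ?thesis by (simp only: infsum_cmult_right' b_def)
  qed
  have "(\<Sum>\<^sub>\<infinity>m. cnj (u m) * (\<Sum>\<^sub>\<infinity>n. \<rho> m n * w n)) =
      (\<Sum>\<^sub>\<infinity>m. \<Sum>\<^sub>\<infinity>k. of_real (p k) * (b k * (cnj (u m) * V m k)))"
    unfolding 1 infsum_cmult_right'[symmetric] by (simp add: algebra_simps)
  also have "\<dots> = (\<Sum>\<^sub>\<infinity>k. of_real (p k) * (\<Sum>\<^sub>\<infinity>m. b k * (cnj (u m) * V m k)))"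
  proof (rule infsum_swap_weighted[OF pc])
    show "l1 (\<lambda>n. b k * (cnj (u n) * V n k))" for k
      using uV[of k] by (subst norm_mult) (rule summable_on_cmult_right)
    have "cmod (b k) * (\<Sum>\<^sub>\<infinity>n. cmod (cnj (u n) * V n k)) \<le>
        (1 + (\<Sum>\<^sub>\<infinity>n. (cmod (w n))\<^sup>2)) * ((\<Sum>\<^sub>\<infinity>n. (cmod (u n))\<^sup>2) + 1)" for k
      by (intro mult_mono b uV') (auto intro!: infsum_nonneg add_nonneg_nonneg)
    then show "(\<Sum>\<^sub>\<infinity>n. cmod (b k * (cnj (u n) * V n k))) \<le>
        (1 + (\<Sum>\<^sub>\<infinity>n. (cmod (w n))\<^sup>2)) * ((\<Sum>\<^sub>\<infinity>n. (cmod (u n))\<^sup>2) + 1)" for k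
      by (subst norm_mult) (simp only: infsum_cmult_right')
  qed
  also have "\<dots> = (\<Sum>\<^sub>\<infinity>k. of_real (p k) * (\<Sum>\<^sub>\<infinity>m. cnj (u m) * V m k) * b k)"
    by (simp only: infsum_cmult_right' mult_ac)
  finally show ?thesis by (simp only: b_def)
qed

text \<open>
  Evaluating \<open>\<langle>v\<^sub>i, \<rho> w\<^sub>j\<rangle>\<close> and \<open>\<langle>v\<^sub>i, \<rho> v\<^sub>i\<rangle>\<close> in both decompositions gives the intertwining
  relation and, after division by \<open>p\<^sub>i\<close>, Parseval's identity for \<open>v\<^sub>i\<close>.
\<close>

lemma spectral_overlap:
  fixes V W :: "'i oper"
  assumes V: "spectral_decomposition \<rho> V p" and W: "spectral_decomposition \<rho> W q"
  defines "c \<equiv> \<lambda>i j. \<Sum>\<^sub>\<infinity>m. cnj (V m i) * W m j"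
  shows "c i j \<noteq> 0 \<Longrightarrow> p i = q j"
    and "p i \<noteq> 0 \<Longrightarrow> (\<Sum>\<^sub>\<infinity>j. ennreal ((cmod (c i j))\<^sup>2)) = 1"
proof -
  have unit: "unitary_op V" "unitary_op W"
    and p: "p summable_on UNIV" "\<And>k. 0 \<le> p k" and q: "q summable_on UNIV" "\<And>k. 0 \<le> q k"
    and \<rho>: "\<rho> = op_conjugate V (op_diag (\<lambda>k. of_real (p k)))"
    "\<rho> = op_conjugate W (op_diag (\<lambda>k. of_real (q k)))"
    using V W unfolding spectral_decomposition_def by (auto intro: has_sum_imp_summable)
  have l2: "l2 (\<lambda>m. V m k)" "l2 (\<lambda>m. W m k)" for k
    using unit[THEN unitary_op_column_norm] by (auto intro: has_sum_imp_summable)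
  note col = unit[THEN unitary_op_columns]
  note form = spectral_form[OF unit(1) p, folded \<rho>(1)] spectral_form[OF unit(2) q, folded \<rho>(2)]
  have cnj_c: "(\<Sum>\<^sub>\<infinity>n. cnj (W n k) * V n i) = cnj (c i k)" for k i
    unfolding c_def infsum_cnj[symmetric] by (simp add: mult.commute)
  have "(\<Sum>\<^sub>\<infinity>m. cnj (V m i) * (\<Sum>\<^sub>\<infinity>n. \<rho> m n * W n j)) = of_real (p i) * c i j" for j
    unfolding form(1)[OF l2(1) l2(2)] c_def col
    by (subst infsum_single_support[of i]) auto
  moreover have "(\<Sum>\<^sub>\<infinity>m. cnj (V m i) * (\<Sum>\<^sub>\<infinity>n. \<rho> m n * W n j)) = of_real (q j) * c i j" for j
    unfolding form(2)[OF l2(1) l2(2)] c_def col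
    by (subst infsum_single_support[of j]) auto
  ultimately have pq: "of_real (p i) * c i j = of_real (q j) * c i j" for j by metis
  from this[of j] show "p i = q j" if "c i j \<noteq> 0" using that by (metis mult_cancel_right of_real_eq_iff)
  assume "p i \<noteq> 0"
  have "of_real (p i) = (\<Sum>\<^sub>\<infinity>m. cnj (V m i) * (\<Sum>\<^sub>\<infinity>n. \<rho> m n * V n i))"
    unfolding form(1)[OF l2(1) l2(1)] c_def col
    by (subst infsum_single_support[of i]) auto
  also have "\<dots> = (\<Sum>\<^sub>\<infinity>j. of_real (q j) * c i j * cnj (c i j))"
    unfolding form(2)[OF l2(1) l2(1)] cnj_c by (simp add: c_def)
  also have "\<dots> = (\<Sum>\<^sub>\<infinity>j. of_real (p i) * (cnj (c i j) * c i j))"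
    by (rule infsum_cong) (simp only: pq[symmetric] mult_ac)
  also have "\<dots> = of_real (p i) * (\<Sum>\<^sub>\<infinity>j. cnj (c i j) * c i j)"
    by (rule infsum_cmult_right')
  finally have "(\<Sum>\<^sub>\<infinity>j. cnj (c i j) * c i j) = 1" using \<open>p i \<noteq> 0\<close> by simp
  then have *: "((\<lambda>j. (cmod (c i j))\<^sup>2) has_sum 1) UNIV" by (simp only: infsum_cmod_square)
  show "(\<Sum>\<^sub>\<infinity>j. ennreal ((cmod (c i j))\<^sup>2)) = 1"
    using infsum_ennreal_of_real[OF has_sum_imp_summable[OF *]] infsumI[OF *] by simp
qed

text \<open>The squared overlaps are supported where \<open>p i = q j\<close>, with row sums 1 where
  \<open>p i \<noteq> 0\<close> and column sums 1 where \<open>q j \<noteq> 0\<close>. Inserting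
  them and swapping sums turns one side into the other; \<open>f 0 = 0\<close> covers the kernel,
  where these sums are not controlled.\<close>

lemma spectral_sum_unique:
  assumes V: "spectral_decomposition \<rho> V p" and W: "spectral_decomposition \<rho> W q"
    and f: "f 0 = 0"
  shows "(\<Sum>\<^sub>\<infinity>k. ennreal (f (p k))) = (\<Sum>\<^sub>\<infinity>k. ennreal (f (q k)))"
proof -
  define c where "c i j = (\<Sum>\<^sub>\<infinity>m. cnj (V m i) * W m j)" for i j
  note VW = spectral_overlap[OF V W, folded c_def]
  have cnj_c: "(\<Sum>\<^sub>\<infinity>m. cnj (W m j) * V m i) = cnj (c i j)" for i j
    unfolding c_def infsum_cnj[symmetric] by (simp add: mult.commute)
  have "(\<Sum>\<^sub>\<infinity>i. ennreal (f (p i))) = (\<Sum>\<^sub>\<infinity>i. \<Sum>\<^sub>\<infinity>j. ennreal (f (p i)) * ennreal ((cmod (c i j))\<^sup>2))"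
    unfolding infsum_ennreal_cmult
  proof (rule infsum_cong)
    fix i
    show "ennreal (f (p i)) = ennreal (f (p i)) * (\<Sum>\<^sub>\<infinity>j. ennreal ((cmod (c i j))\<^sup>2))"
      using VW(2)[of i] f by (cases "p i = 0") auto
  qed
  also have "\<dots> = (\<Sum>\<^sub>\<infinity>i. \<Sum>\<^sub>\<infinity>j. ennreal (f (q j)) * ennreal ((cmod (c i j))\<^sup>2))"
    by (intro infsum_cong) (metis VW(1) ennreal_0 mult_zero_right norm_zero zero_power2)
  also have "\<dots> = (\<Sum>\<^sub>\<infinity>j. ennreal (f (q j)) * (\<Sum>\<^sub>\<infinity>i. ennreal ((cmod (c i j))\<^sup>2)))"
    by (subst infsum_ennreal_swap) (simp only: infsum_ennreal_cmult)
  also have "\<dots> = (\<Sum>\<^sub>\<infinity>j. ennreal (f (q j)))"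
  proof (rule infsum_cong)
    fix j
    show "ennreal (f (q j)) * (\<Sum>\<^sub>\<infinity>i. ennreal ((cmod (c i j))\<^sup>2)) = ennreal (f (q j))"
      using spectral_overlap(2)[OF W V, of j] f by (cases "q j = 0") (auto simp: cnj_c)
  qed
  finally show ?thesis .
qed

text \<open>The upper bound is \<open>ln y \<le> y - 1\<close> at \<open>y = 1 / x\<close>. It keeps
  the diagonal sums of \<open>op_fun\<close> convergent in \<open>vn_entropy_eq\<close>.\<close>

lemma entropy_function_bounds:
  assumes "0 \<le> (x::real)" "x \<le> 1"
  shows "0 \<le> - (x * ln x)" "- (x * ln x) \<le> 1"
proof -
  show "0 \<le> - (x * ln x)"
    using assms by (cases "x = 0") (auto intro!: mult_nonneg_nonpos)
  show "- (x * ln x) \<le> 1"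
  proof (cases "x = 0")
    case False
    then have "- ln x \<le> 1 / x - 1"
      using ln_le_minus_one[of "1 / x"] assms by (simp add: ln_div)
    then have "x * - ln x \<le> x * (1 / x - 1)" by (rule mult_left_mono) fact
    also have "\<dots> = 1 - x" using False by (simp add: right_diff_distrib)
    finally show ?thesis using assms by simp
  qed simp
qed

text \<open>The trace is evaluated in the decomposition that \<open>op_fun\<close> selects, where
  the unit column norms remove \<open>V\<close>; \<open>spectral_sum_unique\<close> then transfers
  the result to the given one.\<close>

lemma vn_entropy_eq:
  assumes W: "spectral_decomposition \<rho> W q"
  shows "vn_entropy \<rho> = (\<Sum>\<^sub>\<infinity>k. ennreal (- (q k * ln (q k))))"
proof -
  define f where "f = (\<lambda>x::real. - (x * ln x))"
  obtain V p where Vp: "(V, p) = (SOME (V, p). spectral_decomposition \<rho> V p)" by (metis surj_pair)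
  have "(\<lambda>(V, p). spectral_decomposition \<rho> V p) (SOME (V, p). spectral_decomposition \<rho> V p)"
    by (rule someI[of _ "(W, q)"]) (simp add: W)
  then have V: "spectral_decomposition \<rho> V p" unfolding Vp[symmetric] by simp
  have op_fun: "op_fun f \<rho> = op_conjugate V (op_diag (\<lambda>k. complex_of_real (f (p k))))"
    unfolding op_fun_def Vp[symmetric] by simp
  have unit: "unitary_op V" and p: "(p has_sum 1) UNIV" "\<And>k. 0 \<le> p k"
    using V by (auto simp: spectral_decomposition_def)
  have "p k \<le> 1" for k
    using finite_sum_le_has_sum[OF p(1), of "{k}"] p(2) by simp
  then have f: "0 \<le> f (p k)" "f (p k) \<le> 1" for k
    unfolding f_def using p(2) entropy_function_bounds by auto
  have diag: "ennreal (Re (op_fun f \<rho> i i)) = (\<Sum>\<^sub>\<infinity>k. ennreal (f (p k)) * ennreal ((cmod (V i k))\<^sup>2))" for i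
  proof -
    have s: "(\<lambda>k. f (p k) * (cmod (V i k))\<^sup>2) summable_on UNIV"
      by (rule summable_on_comparison_test[OF has_sum_imp_summable[OF unitary_op_row_norm[OF unit, of i]]])
        (use f in \<open>auto intro: mult_left_le_one_le\<close>)
    have "op_fun f \<rho> i i = (\<Sum>\<^sub>\<infinity>k. complex_of_real (f (p k) * (cmod (V i k))\<^sup>2))"
      unfolding op_fun op_conjugate_diag by (simp add: complex_norm_square mult_ac del: of_real_power)
    also have "\<dots> = complex_of_real (\<Sum>\<^sub>\<infinity>k. f (p k) * (cmod (V i k))\<^sup>2)"
      by (rule infsumI) (intro has_sum_of_real has_sum_infsum s)
    finally show ?thesis
      using infsum_ennreal_of_real[OF s] f by (simp add: ennreal_mult)
  qed
  have "vn_entropy \<rho> = (\<Sum>\<^sub>\<infinity>k. \<Sum>\<^sub>\<infinity>i. ennreal (f (p k)) * ennreal ((cmod (V i k))\<^sup>2))"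
    unfolding vn_entropy_def f_def[symmetric] diag by (rule infsum_ennreal_swap)
  also have "\<dots> = (\<Sum>\<^sub>\<infinity>k. ennreal (f (p k)))"
    unfolding infsum_ennreal_cmult
    using infsum_ennreal_of_real[OF has_sum_imp_summable[OF unitary_op_column_norm[OF unit]]]
      infsumI[OF unitary_op_column_norm[OF unit]] by simp
  also have "\<dots> = (\<Sum>\<^sub>\<infinity>k. ennreal (f (q k)))"
    by (rule spectral_sum_unique[OF V W]) (simp add: f_def)
  finally show ?thesis by (simp add: f_def)
qed

subsection \<open>Displacement operators\<close>

text \<open>The Fock matrix elements of \<open>exp (u a\<^sup>\<dagger>) w\<^sup>N exp (v a)\<close>, with \<open>N\<close> the number operator.\<close>

definition kernel :: "complex \<Rightarrow> complex \<Rightarrow> complex \<Rightarrow> nat oper" where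
  "kernel u v w m n = of_real (sqrt (fact m * fact n)) *
     (\<Sum>k\<le>min m n. w ^ k * u ^ (m - k) * v ^ (n - k) / (fact k * fact (m - k) * fact (n - k)))"

lemma kernel_commute: "kernel u v w m n = kernel v u w n m"
  by (simp add: kernel_def min.commute[of n m] mult_ac)

lemma kernel_cnj: "cnj (kernel u v w m n) = kernel (cnj u) (cnj v) (cnj w) m n"
  by (simp add: kernel_def)

lemma kernel_0_right: "kernel u v w m 0 = u ^ m / of_real (sqrt (fact m))"
proof -
  have "sqrt (fact m) / fact m = 1 / sqrt (fact m)"
    by (metis fact_ge_zero real_div_sqrt inverse_eq_divide inverse_divide)
  then have "complex_of_real (sqrt (fact m)) / fact m = 1 / of_real (sqrt (fact m))"
    by (metis of_real_1 of_real_divide of_real_fact)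
  then have "complex_of_real (sqrt (fact m)) / fact m * u ^ m = 1 / of_real (sqrt (fact m)) * u ^ m"
    by simp
  then show ?thesis by (simp add: kernel_def)
qed

text \<open>Operator form: \<open>a K = u K + w K a\<close>, since a exp(u a^+) = exp(u a^+) (a + u)
  and a w^N = w w^N a. At \<open>n = 0\<close> the truncated index \<open>n - 1\<close> is harmless,
  its factor being 0.\<close>

lemma kernel_Suc_left:
  "of_real (sqrt (real (Suc m))) * kernel u v w (Suc m) n =
     u * kernel u v w m n + w * of_real (sqrt (real n)) * kernel u v w m (n - 1)"
proof -
  \<comment> \<open>Padding with 0 beyond m makes the summation range depend on n alone, so that the
    sums for m and \<open>Suc m\<close> can be compared term by term.\<close>
  define T :: "nat \<Rightarrow> nat \<Rightarrow> nat \<Rightarrow> complex" where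
    "T m n k = (if k \<le> m \<and> k \<le> n then
       w ^ k * u ^ (m - k) * v ^ (n - k) / (fact k * fact (m - k) * fact (n - k)) else 0)" for m n k
  define s where "s m n = (\<Sum>k\<le>n. T m n k)" for m n
  have kernel: "kernel u v w m n = of_real (sqrt (fact m) * sqrt (fact n)) * s m n" for m n
  proof -
    have "s m n = (\<Sum>k\<le>min m n. T m n k)"
      unfolding s_def by (rule sum.mono_neutral_right) (auto simp: T_def)
    then show ?thesis by (simp add: kernel_def T_def real_sqrt_mult)
  qed
  have T0: "of_nat (Suc m) * T (Suc m) n 0 = u * T m n 0" for n
    by (simp add: T_def field_simps del: of_nat_Suc)
  have T_Suc: "of_nat (Suc m) * T (Suc m) (Suc n) (Suc k) = u * T m (Suc n) (Suc k) + w * T m n k" for n k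
  proof (cases "k \<le> m \<and> k \<le> n")
    case True
    then obtain d e where d: "m = k + d" and e: "n = k + e" by (metis le_add_diff_inverse)
    show ?thesis
    proof (cases d)
      case 0
      then show ?thesis by (simp add: T_def d e field_simps del: of_nat_Suc)
    next
      case (Suc c)
      \<comment> \<open>The summand \<open>Suc k\<close> cancels against \<open>fact (Suc k)\<close>
        and gives the w-term; \<open>Suc c = m - k\<close> cancels against
        \<open>fact (m - k)\<close> and gives the u-term.\<close>
      have "of_nat (Suc m) = (of_nat (Suc k) + of_nat (Suc c) :: complex)"
        by (simp add: d Suc)
      then show ?thesis
        by (simp add: T_def d e Suc divide_simps del: of_nat_Suc) (simp add: algebra_simps del: of_nat_Suc)
    qed
  qed (auto simp: T_def)
  have s: "of_nat (Suc m) * s (Suc m) n = u * s m n + w * (if n = 0 then 0 else s m (n - 1))"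
  proof (cases n)
    case 0
    then show ?thesis by (simp add: s_def T0 del: of_nat_Suc)
  next
    case (Suc l)
    show ?thesis unfolding s_def Suc
      by (simp add: sum.atMost_Suc_shift distrib_left sum_distrib_left T0 T_Suc sum.distrib
          del: of_nat_Suc sum.atMost_Suc)
  qed
  have "of_real (sqrt (real (Suc m))) * kernel u v w (Suc m) n =
      of_real (sqrt (real (Suc m)) * sqrt (fact (Suc m)) * sqrt (fact n)) * s (Suc m) n"
    by (simp add: kernel del: of_nat_Suc fact_Suc)
  also have "\<dots> = of_real (sqrt (fact m) * sqrt (fact n)) * (of_nat (Suc m) * s (Suc m) n)"
    unfolding sqrt_mult_fact by (simp del: of_nat_Suc)
  also have "\<dots> = u * kernel u v w m n +
      w * of_real (sqrt (fact m) * sqrt (fact n)) * (if n = 0 then 0 else s m (n - 1))"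
    unfolding s by (simp add: kernel algebra_simps)
  also have "w * of_real (sqrt (fact m) * sqrt (fact n)) * (if n = 0 then 0 else s m (n - 1)) =
      w * of_real (sqrt (real n)) * kernel u v w m (n - 1)"
    by (cases n) (simp_all add: kernel real_sqrt_mult del: of_nat_Suc)
  finally show ?thesis .
qed

text \<open>The normally ordered form of the Weyl operator exp(\<beta> a^+ - cnj \<beta> a).\<close>

definition displacement :: "complex \<Rightarrow> nat oper" where
  "displacement \<beta> m n = of_real (exp (- (cmod \<beta>)\<^sup>2 / 2)) * kernel \<beta> (- cnj \<beta>) 1 m n"

lemma displacement_0_right: "displacement \<beta> m 0 = coherent_ket \<beta> m"
  by (simp add: displacement_def coherent_ket_def kernel_0_right)

lemma cnj_displacement: "cnj (displacement \<beta> n m) = displacement (- \<beta>) m n"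
  using kernel_commute[of "cnj \<beta>" "- \<beta>" 1 n m] by (simp add: displacement_def kernel_cnj)

lemma displacement_Suc_left:
  "of_real (sqrt (real (Suc m))) * displacement \<beta> (Suc m) n =
     \<beta> * displacement \<beta> m n + of_real (sqrt (real n)) * displacement \<beta> m (n - 1)"
  using arg_cong[OF kernel_Suc_left[of m \<beta> "- cnj \<beta>" 1 n], of "\<lambda>x. of_real (exp (- (cmod \<beta>)\<^sup>2 / 2)) * x"]
  unfolding displacement_def by (simp add: algebra_simps del: of_nat_Suc)

lemma displacement_Suc_right:
  "of_real (sqrt (real (Suc n))) * displacement \<beta> m (Suc n) =
     - cnj \<beta> * displacement \<beta> m n + of_real (sqrt (real m)) * displacement \<beta> (m - 1) n"
  using arg_cong[OF displacement_Suc_left[of n "- \<beta>" m], of cnj]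
  by (simp add: cnj_displacement del: of_nat_Suc)

text \<open>Growth of the form \<open>K * R ^ m / sqrt (fact m)\<close> survives the column
  recursion: the shifted term costs a factor m, and \<open>m \<le> 2 ^ m\<close> is absorbed by
  doubling R. Summability must be known before any inner product of columns is computed.\<close>

lemma displacement_bound:
  "\<exists>K R. 0 \<le> K \<and> 1 \<le> R \<and> (\<forall>m. cmod (displacement \<beta> m n) \<le> K * R ^ m / sqrt (fact m))"
proof (induction n)
  case 0
  have "cmod (displacement \<beta> m 0) \<le> 1 * (cmod \<beta> + 1) ^ m / sqrt (fact m)" for m
  proof -
    have "exp (- (cmod \<beta>)\<^sup>2 / 2) * cmod \<beta> ^ m \<le> 1 * (cmod \<beta> + 1) ^ m"
      by (intro mult_mono power_mono) auto
    then show ?thesis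
      by (simp add: displacement_0_right coherent_ket_def norm_mult norm_divide norm_power divide_right_mono)
  qed
  then show ?case by (intro exI[of _ 1] exI[of _ "cmod \<beta> + 1"]) auto
next
  case (Suc n)
  then obtain K R where KR: "0 \<le> K" "1 \<le> R"
    and D: "\<And>m. cmod (displacement \<beta> m n) \<le> K * R ^ m / sqrt (fact m)" by blast
  have "cmod (displacement \<beta> m (Suc n)) \<le> K * (cmod \<beta> + 1) * (2 * R) ^ m / sqrt (fact m)" for m
  proof -
    have "sqrt (real m) * cmod (displacement \<beta> (m - 1) n) \<le> K * (2 * R) ^ m / sqrt (fact m)"
    proof (cases m)
      case (Suc l)
      have "sqrt (real m) * cmod (displacement \<beta> (m - 1) n) \<le> sqrt (real m) * (K * R ^ (m - 1) / sqrt (fact (m - 1)))"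
        by (intro mult_left_mono D) simp
      also have "\<dots> = (sqrt (real m) / sqrt (fact (m - 1))) * (K * R ^ (m - 1))" by simp
      also have "\<dots> = K * (real m * R ^ (m - 1)) / sqrt (fact m)" by (simp only: sqrt_div_fact) simp
      also have "real m * R ^ (m - 1) \<le> 2 ^ m * R ^ m"
        using KR by (intro mult_mono power_increasing) (auto simp: less_imp_le of_nat_less_two_power)
      finally show ?thesis using KR by (simp add: power_mult_distrib divide_right_mono mult_left_mono)
    qed (use KR in simp)
    moreover have "cmod \<beta> * cmod (displacement \<beta> m n) \<le> cmod \<beta> * (K * (2 * R) ^ m / sqrt (fact m))"
    proof (rule mult_left_mono)
      have "R ^ m \<le> (2 * R) ^ m" using KR by (intro power_mono) auto
      then have "K * R ^ m / sqrt (fact m) \<le> K * (2 * R) ^ m / sqrt (fact m)"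
        using KR by (intro divide_right_mono mult_left_mono) auto
      then show "cmod (displacement \<beta> m n) \<le> K * (2 * R) ^ m / sqrt (fact m)" using D[of m] by linarith
    qed simp
    moreover have "cmod (displacement \<beta> m (Suc n)) \<le> sqrt (real (Suc n)) * cmod (displacement \<beta> m (Suc n))"
      using mult_right_mono[of 1 "sqrt (real (Suc n))" "cmod (displacement \<beta> m (Suc n))"] by simp
    moreover have "sqrt (real (Suc n)) * cmod (displacement \<beta> m (Suc n)) \<le>
        cmod \<beta> * cmod (displacement \<beta> m n) + sqrt (real m) * cmod (displacement \<beta> (m - 1) n)"
      using arg_cong[OF displacement_Suc_right[of n \<beta> m], of cmod]
        norm_triangle_ineq[of "- cnj \<beta> * displacement \<beta> m n" "of_real (sqrt (real m)) * displacement \<beta> (m - 1) n"]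
      by (simp add: norm_mult del: of_nat_Suc)
    ultimately show ?thesis by (simp add: algebra_simps add_divide_distrib)
  qed
  with KR show ?case by (intro exI[of _ "K * (cmod \<beta> + 1)"] exI[of _ "2 * R"]) auto
qed

lemma displacement_column_l2: "l2 (\<lambda>m. displacement \<beta> m n)"
proof -
  obtain K R where KR: "0 \<le> K" "1 \<le> R"
    and D: "\<And>m. cmod (displacement \<beta> m n) \<le> K * R ^ m / sqrt (fact m)"
    using displacement_bound[of \<beta> n] by blast
  show ?thesis
  proof (rule summable_on_comparison_test)
    have "summable (\<lambda>m. inverse (fact m) * (R\<^sup>2) ^ m)" by (rule summable_exp)
    then have "(\<lambda>m. inverse (fact m) * (R\<^sup>2) ^ m) summable_on UNIV"
      by (subst summable_on_UNIV_nonneg_real_iff) auto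
    then show "(\<lambda>m. K\<^sup>2 * (inverse (fact m) * (R\<^sup>2) ^ m)) summable_on UNIV"
      by (rule summable_on_cmult_right)
    fix m
    have "(cmod (displacement \<beta> m n))\<^sup>2 \<le> (K * R ^ m / sqrt (fact m))\<^sup>2"
      by (intro power_mono D) simp
    also have "\<dots> = K\<^sup>2 * (inverse (fact m) * (R\<^sup>2) ^ m)"
      by (simp add: power_mult_distrib power_divide field_simps flip: power_mult)
    finally show "(cmod (displacement \<beta> m n))\<^sup>2 \<le> K\<^sup>2 * (inverse (fact m) * (R\<^sup>2) ^ m)" .
  qed simp
qed

text \<open>These are the entries of the creation operator applied to a column; the column recursion
  expresses them by two columns, so no new estimate is needed.\<close>

lemma displacement_shifted_l2: "l2 (\<lambda>m. of_real (sqrt (real m)) * displacement \<beta> (m - 1) n)"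
proof -
  have eq: "of_real (sqrt (real m)) * displacement \<beta> (m - 1) n =
      of_real (sqrt (real (Suc n))) * displacement \<beta> m (Suc n) + cnj \<beta> * displacement \<beta> m n" for m
    unfolding displacement_Suc_right by simp
  show ?thesis unfolding eq by (intro l2_add l2_cmult displacement_column_l2)
qed

text \<open>The inner product of column i with the annihilation operator applied to column j is
  computed twice, moving the operator to either side. The \<open>\<beta>\<close> terms cancel,
  leaving \<open>step\<close>, which with \<open>G 0 0 = 1\<close> fixes all entries.\<close>

lemma displacement_Gram:
  "(\<Sum>\<^sub>\<infinity>m. cnj (displacement \<beta> m i) * displacement \<beta> m j) = (if i = j then 1 else 0)"
proof -
  define G where "G i j = (\<Sum>\<^sub>\<infinity>m. cnj (displacement \<beta> m i) * displacement \<beta> m j)" for i j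
  have summable: "(\<lambda>m. cnj (x m) * y m) summable_on UNIV" if "l2 x" "l2 y" for x y :: "nat \<Rightarrow> complex"
    using l2_mult_abs_summable[OF l2_cnj[OF that(1)] that(2)] by (rule abs_summable_summable)
  note D = displacement_column_l2 displacement_shifted_l2
  have cnj_G: "cnj (G i j) = G j i" for i j
    unfolding G_def infsum_cnj[symmetric] by (simp add: mult.commute)
  have step: "of_real (sqrt (real (Suc i))) * G (Suc i) j = of_real (sqrt (real j)) * G i (j - 1)" for i j
  proof -
    have "of_real (sqrt (real (Suc i))) * G (Suc i) j + \<beta> * G i j =
        (\<Sum>\<^sub>\<infinity>m. of_real (sqrt (real (Suc i))) * (cnj (displacement \<beta> m (Suc i)) * displacement \<beta> m j)
            + \<beta> * (cnj (displacement \<beta> m i) * displacement \<beta> m j))"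
      unfolding G_def infsum_cmult_right'[symmetric]
      by (intro infsum_add[symmetric] summable_on_cmult_right summable D)
    also have "\<dots> = (\<Sum>\<^sub>\<infinity>m. cnj (of_real (sqrt (real m)) * displacement \<beta> (m - 1) i) * displacement \<beta> m j)"
    proof (rule infsum_cong)
      fix m
      have "of_real (sqrt (real m)) * displacement \<beta> (m - 1) i =
          of_real (sqrt (real (Suc i))) * displacement \<beta> m (Suc i) + cnj \<beta> * displacement \<beta> m i"
        unfolding displacement_Suc_right by simp
      then show "of_real (sqrt (real (Suc i))) * (cnj (displacement \<beta> m (Suc i)) * displacement \<beta> m j)
            + \<beta> * (cnj (displacement \<beta> m i) * displacement \<beta> m j) =
          cnj (of_real (sqrt (real m)) * displacement \<beta> (m - 1) i) * displacement \<beta> m j"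
        by (simp add: algebra_simps del: of_nat_Suc)
    qed
    also have "\<dots> = (\<Sum>\<^sub>\<infinity>m. cnj (displacement \<beta> m i) * (of_real (sqrt (real (Suc m))) * displacement \<beta> (Suc m) j))"
      by (subst infsum_Suc) (simp_all add: mult_ac del: of_nat_Suc)
    also have "\<dots> = (\<Sum>\<^sub>\<infinity>m. \<beta> * (cnj (displacement \<beta> m i) * displacement \<beta> m j) +
        of_real (sqrt (real j)) * (cnj (displacement \<beta> m i) * displacement \<beta> m (j - 1)))"
      unfolding displacement_Suc_left by (simp add: algebra_simps)
    also have "\<dots> = \<beta> * G i j + of_real (sqrt (real j)) * G i (j - 1)"
      unfolding G_def infsum_cmult_right'[symmetric]
      by (intro infsum_add summable_on_cmult_right summable D)
    finally show ?thesis by simp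
  qed
  have G00: "G 0 0 = 1"
  proof -
    have "(\<lambda>m. exp (- (cmod \<beta>)\<^sup>2) * (((cmod \<beta>)\<^sup>2) ^ m /\<^sub>R fact m)) sums (exp (- (cmod \<beta>)\<^sup>2) * exp ((cmod \<beta>)\<^sup>2))"
      by (intro sums_mult exp_converges)
    then have "((\<lambda>m. exp (- (cmod \<beta>)\<^sup>2) * (((cmod \<beta>)\<^sup>2) ^ m /\<^sub>R fact m)) has_sum 1) UNIV"
      by (intro sums_nonneg_imp_has_sum) (auto simp flip: exp_add)
    moreover have "(cmod (displacement \<beta> m 0))\<^sup>2 = exp (- (cmod \<beta>)\<^sup>2) * (((cmod \<beta>)\<^sup>2) ^ m /\<^sub>R fact m)" for m
    proof -
      have "(exp (- (cmod \<beta>)\<^sup>2 / 2))\<^sup>2 = exp (- (cmod \<beta>)\<^sup>2)" by (simp add: exp_double[symmetric])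
      then show ?thesis
        by (simp add: displacement_0_right coherent_ket_def norm_mult norm_divide norm_power
            power_mult_distrib power_divide field_simps flip: power_mult)
    qed
    ultimately show ?thesis unfolding G_def infsum_cmod_square by simp
  qed
  have "G i j = (if i = j then 1 else 0)"
  proof (induction i arbitrary: j)
    case 0
    show ?case
    proof (cases j)
      case (Suc l)
      \<comment> \<open>\<open>step\<close> raises the first index only, so row 0 is obtained from
        column 0 by conjugate symmetry.\<close>
      have "G (Suc l) 0 = 0" using step[of l 0] by (simp del: of_nat_Suc)
      then show ?thesis using cnj_G[of "Suc l" 0] Suc by simp
    qed (simp add: G00)
  next
    case (Suc i)
    show ?case
    proof (cases j)
      case 0
      then show ?thesis using step[of i 0] by (simp del: of_nat_Suc)
    next
      case (Suc l)
      then show ?thesis using step[of i j] Suc.IH[of l] by (auto simp del: of_nat_Suc)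
    qed
  qed
  then show ?thesis by (simp add: G_def)
qed

text \<open>In infinite dimension orthonormal columns alone do not give a unitary. The rows are, up
  to conjugation, columns of the displacement by \<open>- \<beta>\<close>, the adjoint.\<close>

lemma unitary_displacement: "unitary_op (displacement \<beta>)"
proof -
  have "op_mult (op_adj (displacement \<beta>)) (displacement \<beta>) = op_id"
    by (simp add: fun_eq_iff op_mult_def op_adj_def op_id_def op_diag_def displacement_Gram)
  moreover have "op_mult (displacement \<beta>) (op_adj (displacement \<beta>)) i j = op_id i j" for i j
    using displacement_Gram[of "- \<beta>" i j] cnj_displacement[of "- \<beta>"]
    by (simp add: op_mult_def op_adj_def op_id_def op_diag_def cnj_displacement)
  ultimately show ?thesis by (simp add: unitary_op_def fun_eq_iff)
qed

lemma unitary_tensor: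
  assumes A: "unitary_op A" and B: "unitary_op B"
  shows "unitary_op (op_tensor A B)"
proof -
  have l2: "l2 (\<lambda>m. C m k)" "l2 (\<lambda>m. C k m)" if "unitary_op C" for C k
    using that[THEN unitary_op_column_norm] that[THEN unitary_op_row_norm]
    by (auto intro: has_sum_imp_summable)
  have "op_mult (op_adj (op_tensor A B)) (op_tensor A B) (i, k) (j, l) = op_id (i, k) (j, l)" for i k j l
  proof -
    have "op_mult (op_adj (op_tensor A B)) (op_tensor A B) (i, k) (j, l) =
        (\<Sum>\<^sub>\<infinity>(x, y). (cnj (A x i) * A x j) * (cnj (B y k) * B y l))"
      by (simp add: op_mult_def op_adj_def op_tensor_def case_prod_unfold mult_ac)
    also have "\<dots> = (\<Sum>\<^sub>\<infinity>x. cnj (A x i) * A x j) * (\<Sum>\<^sub>\<infinity>y. cnj (B y k) * B y l)"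
      by (intro infsum_prod l2_mult_abs_summable l2_cnj l2 A B)
    finally show ?thesis by (simp add: unitary_op_columns[OF A] unitary_op_columns[OF B] op_id_def op_diag_def)
  qed
  moreover have "op_mult (op_tensor A B) (op_adj (op_tensor A B)) (i, k) (j, l) = op_id (i, k) (j, l)" for i k j l
  proof -
    have "op_mult (op_tensor A B) (op_adj (op_tensor A B)) (i, k) (j, l) =
        (\<Sum>\<^sub>\<infinity>(x, y). (A i x * cnj (A j x)) * (B k y * cnj (B l y)))"
      by (simp add: op_mult_def op_adj_def op_tensor_def case_prod_unfold mult_ac)
    also have "\<dots> = (\<Sum>\<^sub>\<infinity>x. A i x * cnj (A j x)) * (\<Sum>\<^sub>\<infinity>y. B k y * cnj (B l y))"
      by (intro infsum_prod l2_mult_abs_summable l2_cnj l2 A B)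
    finally show ?thesis by (simp add: unitary_op_rows[OF A] unitary_op_rows[OF B] op_id_def op_diag_def)
  qed
  ultimately show ?thesis by (simp add: unitary_op_def fun_eq_iff)
qed

subsection \<open>Thermal states\<close>

definition thermal_weight :: "real \<Rightarrow> nat \<Rightarrow> real" where
  "thermal_weight N n = N ^ n / (N + 1) ^ (n + 1)"

lemma thermal_weight_nonneg: "0 < N \<Longrightarrow> 0 \<le> thermal_weight N n"
  by (simp add: thermal_weight_def)

lemma thermal_weight_geometric: "thermal_weight N n = (1 / (N + 1)) * (N / (N + 1)) ^ n"
  by (simp add: thermal_weight_def power_divide)

lemma thermal_weight_Suc: "thermal_weight N (Suc n) = N / (N + 1) * thermal_weight N n"
  by (simp add: thermal_weight_geometric)

lemma thermal_weight_has_sum: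
  assumes "0 < N"
  shows "(thermal_weight N has_sum 1) UNIV"
proof -
  have "(\<lambda>n. (1 / (N + 1)) * (N / (N + 1)) ^ n) sums ((1 / (N + 1)) * (1 / (1 - N / (N + 1))))"
    using assms by (intro sums_mult geometric_sums) simp
  also have "(1 / (N + 1)) * (1 / (1 - N / (N + 1))) = 1" using assms by (simp add: divide_simps)
  finally show ?thesis
    using assms unfolding thermal_weight_geometric[abs_def] by (intro sums_nonneg_imp_has_sum) auto
qed

lemma thermal_weight_mean:
  assumes "0 < N"
  shows "((\<lambda>n. real n * thermal_weight N n) has_sum N) UNIV"
proof -
  have "(\<lambda>n. (N / (N + 1)\<^sup>2) * (of_nat (Suc n) * (N / (N + 1)) ^ n)) sums
      ((N / (N + 1)\<^sup>2) * (1 / (1 - N / (N + 1))\<^sup>2))"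
    using assms by (intro sums_mult geometric_deriv_sums) simp
  also have "(N / (N + 1)\<^sup>2) * (1 / (1 - N / (N + 1))\<^sup>2) = N"
    using assms by (simp add: divide_simps power2_eq_square)
  also have "(\<lambda>n. (N / (N + 1)\<^sup>2) * (of_nat (Suc n) * (N / (N + 1)) ^ n)) =
      (\<lambda>n. real (Suc n) * thermal_weight N (Suc n))"
    using assms by (simp add: fun_eq_iff thermal_weight_geometric power2_eq_square field_simps del: of_nat_Suc)
  finally have "(\<lambda>n. real n * thermal_weight N n) sums (N + real 0 * thermal_weight N 0)"
    by (rule sums_Suc)
  then show ?thesis
    using assms by (intro sums_nonneg_imp_has_sum) (auto simp: thermal_weight_nonneg)
qed

text \<open>The generalized binomial series for exponent \<open>- (r + 1)\<close>, evaluated at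
  \<open>- x\<close>.\<close>

lemma negative_binomial_sums:
  assumes "0 \<le> (x::real)" "x < 1"
  shows "(\<lambda>k. real ((k + r) choose r) * x ^ k) sums (1 / (1 - x) ^ Suc r)"
proof -
  have "(\<lambda>k. (- real (Suc r) gchoose k) * (- x) ^ k) sums (1 + - x) powr (- real (Suc r))"
    using assms by (intro gen_binomial_real) simp
  moreover have "(- real (Suc r) gchoose k) * (- x) ^ k = real ((k + r) choose r) * x ^ k" for k
  proof -
    have "real (Suc r) + real k - 1 = real (k + r)" by simp
    then have "(- real (Suc r) gchoose k) = (-1) ^ k * (real (k + r) gchoose k)"
      by (simp only: gbinomial_minus)
    also have "real (k + r) gchoose k = real ((k + r) choose k)" by (simp only: binomial_gbinomial)
    also have "(k + r) choose k = (k + r) choose r" using binomial_symmetric[of k "k + r"] by simp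
    finally show ?thesis by (simp add: power_minus[of x])
  qed
  moreover have "(1 + - x) powr (- real (Suc r)) = 1 / (1 - x) ^ Suc r"
    using assms by (simp only: powr_minus powr_realpow) (simp add: inverse_eq_divide)
  ultimately show ?thesis by simp
qed

text \<open>The probability that \<open>r\<close> of \<open>l\<close> photons are transmitted when each is with probability \<open>1 - \<eta>\<close>.\<close>

definition binomial_weight :: "real \<Rightarrow> nat \<Rightarrow> nat \<Rightarrow> real" where
  "binomial_weight \<eta> l r = real (l choose r) * (1 - \<eta>) ^ r * \<eta> ^ (l - r)"

lemma binomial_weight_nonneg: "0 < \<eta> \<Longrightarrow> \<eta> < 1 \<Longrightarrow> 0 \<le> binomial_weight \<eta> l r"
  by (simp add: binomial_weight_def)

lemma binomial_weight_eq_0: "l < r \<Longrightarrow> binomial_weight \<eta> l r = 0"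
  by (simp add: binomial_weight_def)

lemma binomial_weight_sum: "(\<Sum>r\<le>l. binomial_weight \<eta> l r) = 1"
  using binomial_ring[of "1 - \<eta>" \<eta> l] by (simp add: binomial_weight_def)

text \<open>Binomial thinning of a geometric law is again geometric. With \<open>l = k + r\<close>
  the sum is a negative binomial series in \<open>x = N * \<eta> / (N + 1)\<close>, and
  \<open>1 - x = ((1 - \<eta>) * N + 1) / (N + 1)\<close> supplies the new denominator.\<close>

lemma thermal_weight_thinning:
  assumes N: "0 < N" and \<eta>: "0 < \<eta>" "\<eta> < 1"
  shows "((\<lambda>l. thermal_weight N l * binomial_weight \<eta> l r) has_sum thermal_weight ((1 - \<eta>) * N) r) UNIV"
proof -
  define x where "x = N * \<eta> / (N + 1)"
  have "N * \<eta> < N * 1" using assms by (intro mult_strict_left_mono)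
  then have "N * \<eta> < N + 1" by linarith
  then have x: "0 \<le> x" "x < 1" using assms by (auto simp: x_def)
  have x1: "1 - x = ((1 - \<eta>) * N + 1) / (N + 1)" using N by (simp add: x_def field_simps)
  define K where "K = ((1 - \<eta>) * N) ^ r / (N + 1) ^ Suc r"
  have "(\<lambda>k. K * (real ((k + r) choose r) * x ^ k)) sums (K * (1 / (1 - x) ^ Suc r))"
    by (intro sums_mult negative_binomial_sums x)
  also have "K * (1 / (1 - x) ^ Suc r) = thermal_weight ((1 - \<eta>) * N) r"
    unfolding x1 K_def thermal_weight_def power_divide using N by simp
  finally have "(\<lambda>k. K * (real ((k + r) choose r) * x ^ k)) sums thermal_weight ((1 - \<eta>) * N) r" .
  then have "((\<lambda>k. K * (real ((k + r) choose r) * x ^ k)) has_sum thermal_weight ((1 - \<eta>) * N) r) UNIV"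
    by (rule sums_nonneg_imp_has_sum) (use x assms in \<open>auto simp: K_def\<close>)
  moreover have "K * (real ((k + r) choose r) * x ^ k) = thermal_weight N (k + r) * binomial_weight \<eta> (k + r) r" for k
    by (simp add: K_def x_def thermal_weight_def binomial_weight_def power_add power_mult_distrib power_divide mult_ac)
  ultimately have "((\<lambda>k. thermal_weight N (k + r) * binomial_weight \<eta> (k + r) r) has_sum
      thermal_weight ((1 - \<eta>) * N) r) UNIV" by simp
  then have "((\<lambda>l. thermal_weight N l * binomial_weight \<eta> l r) has_sum
      thermal_weight ((1 - \<eta>) * N) r) (range (\<lambda>k. k + r))"
    by (subst has_sum_reindex) (auto simp: o_def)
  then show ?thesis
  proof (subst has_sum_cong_neutral[where T = "range (\<lambda>k. k + r)"])
    show "thermal_weight N l * binomial_weight \<eta> l r = 0" if "l \<in> UNIV - range (\<lambda>k. k + r)" for l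
    proof -
      have "l < r" using that by (metis DiffD2 le_add_diff_inverse2 not_le rangeI)
      then show ?thesis by (simp add: binomial_weight_eq_0)
    qed
  qed auto
qed


subsection \<open>The bosonic channel on a coherent state\<close>

lemma coherent_ket_Suc:
  "of_real (sqrt (real (Suc n))) * coherent_ket a (Suc n) = a * coherent_ket a n"
  using displacement_Suc_left[of n a 0] by (simp add: displacement_0_right del: of_nat_Suc)

text \<open>The beamsplitter applied to the product of a coherent state and the \<open>l\<close>-photon state.\<close>

definition mixed_ket :: "real \<Rightarrow> complex \<Rightarrow> nat \<Rightarrow> nat \<Rightarrow> nat \<Rightarrow> complex" where
  "mixed_ket \<eta> a l p q = beamsplitter \<eta> (p, q) (p + q - l, l) * coherent_ket a (p + q - l)"

text \<open>The beamsplitter relations applied to the product of a coherent and a number state: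
  annihilation multiplies the former by a, and lowers the latter with factor
  \<open>sqrt (real l)\<close>.\<close>

lemma mixed_ket_Suc:
  shows "of_real (sqrt (real (Suc p))) * mixed_ket \<eta> a l (Suc p) q =
      of_real (sqrt \<eta>) * a * mixed_ket \<eta> a l p q +
      of_real (sqrt (1 - \<eta>)) * of_real (sqrt (real l)) * mixed_ket \<eta> a (l - 1) p q" (is ?fst)
    and "of_real (sqrt (real (Suc q))) * mixed_ket \<eta> a l p (Suc q) =
      - of_real (sqrt (1 - \<eta>)) * a * mixed_ket \<eta> a l p q +
      of_real (sqrt \<eta>) * of_real (sqrt (real l)) * mixed_ket \<eta> a (l - 1) p q" (is ?snd)
proof -
  define U where "U = beamsplitter \<eta> (p, q)"
  define n where "n = Suc (p + q) - l"
  \<comment> \<open>For \<open>l > p + q\<close> the truncated subtraction gives photon number 0,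
    but then the beamsplitter entry in \<open>mixed_ket\<close> violates photon conservation and is
    0.\<close>
  have 1: "of_real (sqrt (real n)) * U (n - 1, l) * coherent_ket a n = a * mixed_ket \<eta> a l p q"
  proof (cases "l \<le> p + q")
    case True
    then have "n = Suc (p + q - l)" by (simp add: n_def)
    then show ?thesis
      using coherent_ket_Suc[of "p + q - l" a] by (simp add: mixed_ket_def U_def mult_ac del: of_nat_Suc)
  qed (auto simp: n_def mixed_ket_def U_def beamsplitter_def)
  have 2: "of_real (sqrt (real l)) * U (n, l - 1) * coherent_ket a n =
      of_real (sqrt (real l)) * mixed_ket \<eta> a (l - 1) p q"
    by (cases l) (simp_all add: n_def mixed_ket_def U_def)
  have "of_real (sqrt (real (Suc p))) * beamsplitter \<eta> (Suc p, q) (n, l) =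
      of_real (sqrt \<eta>) * (of_real (sqrt (real n)) * U (n - 1, l)) +
      of_real (sqrt (1 - \<eta>)) * (of_real (sqrt (real l)) * U (n, l - 1))"
    using beamsplitter_fst[of \<eta> "(p, q)" "(n, l)"]
    unfolding op_mult_annihilation_fst_left op_mult_annihilation_fst_right op_mult_annihilation_snd_right U_def .
  from arg_cong[OF this, of "\<lambda>x. x * coherent_ket a n"]
  have "of_real (sqrt (real (Suc p))) * mixed_ket \<eta> a l (Suc p) q =
      of_real (sqrt \<eta>) * (of_real (sqrt (real n)) * U (n - 1, l) * coherent_ket a n) +
      of_real (sqrt (1 - \<eta>)) * (of_real (sqrt (real l)) * U (n, l - 1) * coherent_ket a n)"
    by (simp only: mixed_ket_def[of _ _ _ "Suc p"] add_Suc n_def[symmetric] distrib_right mult.assoc)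
  then show ?fst unfolding 1 2 by (simp only: mult.assoc)
  have "of_real (sqrt (real (Suc q))) * beamsplitter \<eta> (p, Suc q) (n, l) =
      - of_real (sqrt (1 - \<eta>)) * (of_real (sqrt (real n)) * U (n - 1, l)) +
      of_real (sqrt \<eta>) * (of_real (sqrt (real l)) * U (n, l - 1))"
    using beamsplitter_snd[of \<eta> "(p, q)" "(n, l)"]
    unfolding op_mult_annihilation_snd_left op_mult_annihilation_fst_right op_mult_annihilation_snd_right U_def .
  from arg_cong[OF this, of "\<lambda>x. x * coherent_ket a n"]
  have "of_real (sqrt (real (Suc q))) * mixed_ket \<eta> a l p (Suc q) =
      - of_real (sqrt (1 - \<eta>)) * (of_real (sqrt (real n)) * U (n - 1, l) * coherent_ket a n) +
      of_real (sqrt \<eta>) * (of_real (sqrt (real l)) * U (n, l - 1) * coherent_ket a n)"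
    by (simp only: mixed_ket_def[of _ _ _ p "Suc q"] add_Suc_right n_def[symmetric] distrib_right mult.assoc)
  then show ?snd unfolding 1 2 by (simp only: mult.assoc)
qed

text \<open>
  The same vector obtained by moving the displacement through the beamsplitter:
  \<open>U (D(a) \<otimes> 1) = (D(\<surd>\<eta> a) \<otimes> D(- \<surd>(1 - \<eta>) a)) U\<close>, applied to \<open>|0, l\<rangle>\<close>.
\<close>

definition split_ket :: "real \<Rightarrow> complex \<Rightarrow> nat \<Rightarrow> nat \<Rightarrow> nat \<Rightarrow> complex" where
  "split_ket \<eta> a l p q = (\<Sum>r\<le>l. of_real (sqrt (binomial_weight \<eta> l r)) *
     displacement (of_real (sqrt \<eta>) * a) p r * displacement (- of_real (sqrt (1 - \<eta>)) * a) q (l - r))"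

lemma sqrt_binomial_weight_Suc_Suc:
  "sqrt (real (Suc r)) * sqrt (binomial_weight \<eta> (Suc l) (Suc r)) =
     sqrt (1 - \<eta>) * sqrt (real (Suc l)) * sqrt (binomial_weight \<eta> l r)"
proof -
  have "real (Suc r) * real (Suc l choose Suc r) = real (Suc l) * real (l choose r)"
    by (metis Suc_times_binomial of_nat_mult)
  then have "real (Suc r) * binomial_weight \<eta> (Suc l) (Suc r) = (1 - \<eta>) * real (Suc l) * binomial_weight \<eta> l r"
    by (simp add: binomial_weight_def del: of_nat_Suc binomial_Suc_Suc)
  then show ?thesis by (simp only: flip: real_sqrt_mult)
qed

lemma sqrt_binomial_weight_Suc:
  assumes "r \<le> l"
  shows "sqrt (real (Suc l - r)) * sqrt (binomial_weight \<eta> (Suc l) r) =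
     sqrt \<eta> * sqrt (real (Suc l)) * sqrt (binomial_weight \<eta> l r)"
proof -
  have "real (Suc l - r) * real (Suc l choose r) = real (Suc l) * real (l choose r)"
    by (metis binomial_absorb_comp diff_Suc_1 of_nat_mult)
  then have "real (Suc l - r) * binomial_weight \<eta> (Suc l) r = \<eta> * real (Suc l) * binomial_weight \<eta> l r"
    using assms by (simp add: binomial_weight_def Suc_diff_le del: of_nat_Suc binomial_Suc_Suc)
  then show ?thesis by (simp only: flip: real_sqrt_mult)
qed

text \<open>Annihilation passes through a displacement and leaves its amplitude. The remaining sum
  returns to \<open>l - 1\<close> by the absorption identities for binomial coefficients, taken
  under square roots. The result is the recursion of \<open>mixed_ket_Suc\<close>.\<close>

lemma split_ket_Suc:
  shows "of_real (sqrt (real (Suc p))) * split_ket \<eta> a l (Suc p) q =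
      of_real (sqrt \<eta>) * a * split_ket \<eta> a l p q +
      of_real (sqrt (1 - \<eta>)) * of_real (sqrt (real l)) * split_ket \<eta> a (l - 1) p q" (is ?fst)
    and "of_real (sqrt (real (Suc q))) * split_ket \<eta> a l p (Suc q) =
      - of_real (sqrt (1 - \<eta>)) * a * split_ket \<eta> a l p q +
      of_real (sqrt \<eta>) * of_real (sqrt (real l)) * split_ket \<eta> a (l - 1) p q" (is ?snd)
proof -
  define x where "x = of_real (sqrt \<eta>) * a"
  define y where "y = - of_real (sqrt (1 - \<eta>)) * a"
  define w where "w l r = complex_of_real (sqrt (binomial_weight \<eta> l r))" for l r
  note split = split_ket_def[of \<eta> a, folded x_def y_def w_def]
  have w1: "of_real (sqrt (real (Suc r))) * w (Suc m) (Suc r) =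
      of_real (sqrt (1 - \<eta>)) * of_real (sqrt (real (Suc m))) * w m r" for m r
    unfolding w_def of_real_mult[symmetric] sqrt_binomial_weight_Suc_Suc ..
  have w2: "of_real (sqrt (real (Suc m - r))) * w (Suc m) r =
      of_real (sqrt \<eta>) * of_real (sqrt (real (Suc m))) * w m r" if "r \<le> m" for m r
    unfolding w_def of_real_mult[symmetric] sqrt_binomial_weight_Suc[OF that] ..
  have "of_real (sqrt (real (Suc p))) * split_ket \<eta> a l (Suc p) q =
      (\<Sum>r\<le>l. w l r * (of_real (sqrt (real (Suc p))) * displacement x (Suc p) r) * displacement y q (l - r))"
    by (simp only: split sum_distrib_left mult_ac)
  also have "\<dots> = x * split_ket \<eta> a l p q +
      (\<Sum>r\<le>l. of_real (sqrt (real r)) * w l r * displacement x p (r - 1) * displacement y q (l - r))"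
    unfolding displacement_Suc_left split by (simp add: algebra_simps sum.distrib sum_distrib_left)
  also have "(\<Sum>r\<le>l. of_real (sqrt (real r)) * w l r * displacement x p (r - 1) * displacement y q (l - r)) =
      of_real (sqrt (1 - \<eta>)) * of_real (sqrt (real l)) * split_ket \<eta> a (l - 1) p q"
  proof (cases l)
    case (Suc m)
    have "(\<Sum>r\<le>l. of_real (sqrt (real r)) * w l r * displacement x p (r - 1) * displacement y q (l - r)) =
        (\<Sum>r\<le>m. of_real (sqrt (real (Suc r))) * w (Suc m) (Suc r) * displacement x p r * displacement y q (m - r))"
      unfolding Suc by (subst sum.atMost_Suc_shift) simp
    then show ?thesis unfolding w1 unfolding split Suc by (simp add: sum_distrib_left mult_ac del: of_nat_Suc)
  qed simp
  finally show ?fst by (simp only: x_def)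
  have "of_real (sqrt (real (Suc q))) * split_ket \<eta> a l p (Suc q) =
      (\<Sum>r\<le>l. w l r * displacement x p r * (of_real (sqrt (real (Suc q))) * displacement y (Suc q) (l - r)))"
    by (simp only: split sum_distrib_left mult_ac)
  also have "\<dots> = y * split_ket \<eta> a l p q +
      (\<Sum>r\<le>l. of_real (sqrt (real (l - r))) * w l r * displacement x p r * displacement y q (l - r - 1))"
    unfolding displacement_Suc_left split by (simp add: algebra_simps sum.distrib sum_distrib_left)
  also have "(\<Sum>r\<le>l. of_real (sqrt (real (l - r))) * w l r * displacement x p r * displacement y q (l - r - 1)) =
      of_real (sqrt \<eta>) * of_real (sqrt (real l)) * split_ket \<eta> a (l - 1) p q"
  proof (cases l)
    case (Suc m)
    have "(\<Sum>r\<le>l. of_real (sqrt (real (l - r))) * w l r * displacement x p r * displacement y q (l - r - 1)) =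
        (\<Sum>r\<le>m. of_real (sqrt (real (Suc m - r))) * w (Suc m) r * displacement x p r * displacement y q (m - r))"
      unfolding Suc by simp
    also have "\<dots> = (\<Sum>r\<le>m. of_real (sqrt \<eta>) * of_real (sqrt (real (Suc m))) * w m r * displacement x p r * displacement y q (m - r))"
      by (rule sum.cong) (use w2 in auto)
    finally show ?thesis unfolding split Suc by (simp add: sum_distrib_left mult_ac del: of_nat_Suc)
  qed simp
  finally show ?snd by (simp only: y_def)
qed

lemma displacement_0_left: "displacement \<beta> 0 r = cnj (coherent_ket (- \<beta>) r)"
  using cnj_displacement[of "- \<beta>" r 0] by (simp add: displacement_0_right)

text \<open>The two Gaussian factors combine because \<open>s\<^sup>2 + t\<^sup>2 = 1\<close>, and
  the sum over r is the binomial expansion of \<open>(- z + z) ^ l\<close> with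
  \<open>z = s * t * cnj a\<close>.\<close>

lemma split_ket_0_0:
  assumes "0 < \<eta>" "\<eta> < 1"
  shows "split_ket \<eta> a l 0 0 = (if l = 0 then coherent_ket a 0 else 0)"
proof -
  define s t where "s = sqrt \<eta>" and "t = sqrt (1 - \<eta>)"
  have st: "0 \<le> s" "0 \<le> t" "s\<^sup>2 = \<eta>" "t\<^sup>2 = 1 - \<eta>" using assms by (auto simp: s_def t_def)
  have exps: "exp (- (s * cmod a)\<^sup>2 / 2) * exp (- (t * cmod a)\<^sup>2 / 2) = exp (- (cmod a)\<^sup>2 / 2)"
    unfolding exp_add[symmetric] power_mult_distrib st by (simp add: field_simps)
  have "of_real (sqrt (binomial_weight \<eta> l r)) *
      displacement (of_real s * a) 0 r * displacement (- of_real t * a) 0 (l - r) =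
      of_real (exp (- (cmod a)\<^sup>2 / 2) / sqrt (fact l)) *
      (of_nat (l choose r) * (- (of_real (s * t) * cnj a)) ^ r * (of_real (s * t) * cnj a) ^ (l - r))"
    if r: "r \<le> l" for r
  proof -
    have w: "sqrt (binomial_weight \<eta> l r) = sqrt (real (l choose r)) * t ^ r * s ^ (l - r)"
      by (simp add: binomial_weight_def real_sqrt_mult real_sqrt_power s_def t_def)
    have "sqrt (real (l choose r)) / (sqrt (fact r) * sqrt (fact (l - r))) = real (l choose r) / sqrt (fact l)"
    proof -
      have "real (l choose r) / (fact r * fact (l - r)) = (real (l choose r))\<^sup>2 / fact l"
        unfolding binomial_fact[OF r, where 'a = real] by (simp add: power2_eq_square)
      then have "sqrt (real (l choose r) / (fact r * fact (l - r))) = sqrt ((real (l choose r))\<^sup>2 / fact l)"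
        by (rule arg_cong)
      then show ?thesis by (simp add: real_sqrt_divide real_sqrt_mult)
    qed
    then have b: "of_real (sqrt (real (l choose r))) / (of_real (sqrt (fact r)) * of_real (sqrt (fact (l - r)))) =
        (of_nat (l choose r) / of_real (sqrt (fact l)) :: complex)"
      by (metis of_real_divide of_real_mult of_real_of_nat_eq)
    have c: "displacement (of_real s * a) 0 r = of_real (exp (- (s * cmod a)\<^sup>2 / 2)) / of_real (sqrt (fact r)) * (- (of_real s * cnj a)) ^ r"
      "displacement (- of_real t * a) 0 (l - r) = of_real (exp (- (t * cmod a)\<^sup>2 / 2)) / of_real (sqrt (fact (l - r))) * (of_real t * cnj a) ^ (l - r)"
      using st by (simp_all add: displacement_0_left coherent_ket_def norm_mult)
    have "of_real (sqrt (binomial_weight \<eta> l r)) *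
        displacement (of_real s * a) 0 r * displacement (- of_real t * a) 0 (l - r) =
        of_real (exp (- (s * cmod a)\<^sup>2 / 2) * exp (- (t * cmod a)\<^sup>2 / 2)) *
        (of_real (sqrt (real (l choose r))) / (of_real (sqrt (fact r)) * of_real (sqrt (fact (l - r))))) *
        ((of_real t * - (of_real s * cnj a)) ^ r * (of_real s * (of_real t * cnj a)) ^ (l - r))"
      unfolding w c power_mult_distrib[of "of_real t"] power_mult_distrib[of "of_real s"] by simp
    also have "\<dots> = of_real (exp (- (cmod a)\<^sup>2 / 2)) * (of_nat (l choose r) / of_real (sqrt (fact l))) *
        ((- (of_real (s * t) * cnj a)) ^ r * (of_real (s * t) * cnj a) ^ (l - r))"
      unfolding exps b by (simp add: mult_ac)
    finally show ?thesis by simp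
  qed
  then have "split_ket \<eta> a l 0 0 = of_real (exp (- (cmod a)\<^sup>2 / 2) / sqrt (fact l)) *
      (\<Sum>r\<le>l. of_nat (l choose r) * (- (of_real (s * t) * cnj a)) ^ r * (of_real (s * t) * cnj a) ^ (l - r))"
    unfolding split_ket_def s_def[symmetric] t_def[symmetric] sum_distrib_left by (intro sum.cong) auto
  also have "(\<Sum>r\<le>l. of_nat (l choose r) * (- (of_real (s * t) * cnj a)) ^ r * (of_real (s * t) * cnj a) ^ (l - r)) = (0::complex) ^ l"
    unfolding binomial_ring[symmetric] by simp
  finally show ?thesis by (auto simp: coherent_ket_def)
qed

text \<open>Both sides satisfy the same recursions in p and q and agree at the vacuum. The
  inductions keep l arbitrary because the recursions refer to \<open>l - 1\<close>.\<close>

lemma mixed_ket_eq_split_ket: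
  assumes "0 < \<eta>" "\<eta> < 1"
  shows "mixed_ket \<eta> a l p q = split_ket \<eta> a l p q"
proof -
  have 0: "mixed_ket \<eta> a l 0 0 = split_ket \<eta> a l 0 0" (is ?eq) for l
  proof (cases l)
    case 0
    then show ?eq by (simp add: mixed_ket_def beamsplitter_vacuum split_ket_0_0[OF assms])
  next
    case (Suc m)
    then show ?eq by (simp add: mixed_ket_def beamsplitter_def split_ket_0_0[OF assms])
  qed
  have q: "mixed_ket \<eta> a l 0 q = split_ket \<eta> a l 0 q" for l q
  proof (induction q arbitrary: l)
    case (Suc q)
    have "of_real (sqrt (real (Suc q))) * mixed_ket \<eta> a l 0 (Suc q) =
        of_real (sqrt (real (Suc q))) * split_ket \<eta> a l 0 (Suc q)"
      unfolding mixed_ket_Suc split_ket_Suc Suc.IH ..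
    then show ?case by (simp del: of_nat_Suc)
  qed (rule 0)
  show ?thesis
  proof (induction p arbitrary: l)
    case (Suc p)
    have "of_real (sqrt (real (Suc p))) * mixed_ket \<eta> a l (Suc p) q =
        of_real (sqrt (real (Suc p))) * split_ket \<eta> a l (Suc p) q"
      unfolding mixed_ket_Suc split_ket_Suc Suc.IH ..
    then show ?case by (simp del: of_nat_Suc)
  qed (rule q)
qed

lemma has_sum_sum:
  fixes f :: "'a \<Rightarrow> 'b \<Rightarrow> 'c::{topological_comm_monoid_add, t2_space}"
  assumes "\<And>x. x \<in> F \<Longrightarrow> (f x has_sum s x) A"
  shows "((\<lambda>y. \<Sum>x\<in>F. f x y) has_sum (\<Sum>x\<in>F. s x)) A"
  using assms by (induction F rule: infinite_finite_induct) (auto intro: has_sum_add)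

lemma displacement_Gram_has_sum:
  "((\<lambda>m. displacement \<beta> m i * cnj (displacement \<beta> m j)) has_sum (if i = j then 1 else 0)) UNIV"
proof -
  have "l1 (\<lambda>m. displacement \<beta> m i * cnj (displacement \<beta> m j))"
    by (intro l2_mult_abs_summable l2_cnj displacement_column_l2)
  then have "(\<lambda>m. displacement \<beta> m i * cnj (displacement \<beta> m j)) summable_on UNIV"
    by (rule abs_summable_summable)
  then show ?thesis
    using displacement_Gram[of \<beta> j i] by (auto simp: has_sum_iff mult.commute)
qed

text \<open>Tracing out the lost mode for a fixed number l of environment photons: its displaced
  number states are orthonormal, so the cross terms between different r vanish.\<close>

lemma mixed_ket_overlap:
  fixes a :: complex
  assumes \<eta>: "0 < \<eta>" "\<eta> < 1"
  defines "\<beta> \<equiv> of_real (sqrt \<eta>) * a"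
  shows "((\<lambda>q. mixed_ket \<eta> a l i q * cnj (mixed_ket \<eta> a l j q)) has_sum
    (\<Sum>r\<le>l. of_real (binomial_weight \<eta> l r) * (displacement \<beta> i r * cnj (displacement \<beta> j r)))) UNIV"
proof -
  define y where "y = - of_real (sqrt (1 - \<eta>)) * a"
  define w where "w r = complex_of_real (sqrt (binomial_weight \<eta> l r))" for r
  have cnj_w: "cnj (w r) = w r" for r by (simp add: w_def)
  have "mixed_ket \<eta> a l i q * cnj (mixed_ket \<eta> a l j q) = (\<Sum>r\<le>l. \<Sum>s\<le>l.
      (w r * w s * displacement \<beta> i r * cnj (displacement \<beta> j s)) *
      (displacement y q (l - r) * cnj (displacement y q (l - s))))" for q
    unfolding mixed_ket_eq_split_ket[OF \<eta>] split_ket_def \<beta>_def[symmetric] y_def[symmetric] w_def[symmetric]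
      cnj_sum sum_product complex_cnj_mult by (intro sum.cong refl) (simp only: cnj_w mult_ac)
  moreover have "((\<lambda>q. \<Sum>r\<le>l. \<Sum>s\<le>l. (w r * w s * displacement \<beta> i r * cnj (displacement \<beta> j s)) *
      (displacement y q (l - r) * cnj (displacement y q (l - s)))) has_sum
      (\<Sum>r\<le>l. \<Sum>s\<le>l. (w r * w s * displacement \<beta> i r * cnj (displacement \<beta> j s)) * (if l - r = l - s then 1 else 0))) UNIV"
    by (intro has_sum_sum has_sum_cmult_right displacement_Gram_has_sum)
  \<comment> \<open>For \<open>r\<close> and \<open>s\<close> at most \<open>l\<close> the truncated
    differences \<open>l - r\<close> and \<open>l - s\<close> agree only if
    \<open>r = s\<close>.\<close>
  moreover have "(\<Sum>s\<le>l. (w r * w s * displacement \<beta> i r * cnj (displacement \<beta> j s)) * (if l - r = l - s then 1 else 0)) =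
      of_real (binomial_weight \<eta> l r) * (displacement \<beta> i r * cnj (displacement \<beta> j r))" if "r \<le> l" for r
  proof -
    have "(\<Sum>s\<le>l. (w r * w s * displacement \<beta> i r * cnj (displacement \<beta> j s)) * (if l - r = l - s then 1 else 0)) =
        (\<Sum>s\<le>l. if s = r then w r * w r * displacement \<beta> i r * cnj (displacement \<beta> j r) else 0)"
      using that by (intro sum.cong) auto
    also have "\<dots> = w r * w r * (displacement \<beta> i r * cnj (displacement \<beta> j r))" using that by simp
    also have "w r * w r = of_real (binomial_weight \<eta> l r)"
      unfolding w_def of_real_mult[symmetric] using binomial_weight_nonneg[OF \<eta>] by simp
    finally show ?thesis .
  qed
  ultimately show ?thesis by simp
qed

lemma mixed_ket_l2:
  assumes \<eta>: "0 < \<eta>" "\<eta> < 1"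
  shows "l2 (mixed_ket \<eta> a l i)" and "(\<Sum>\<^sub>\<infinity>q. (cmod (mixed_ket \<eta> a l i q))\<^sup>2) \<le> 1"
proof -
  define \<beta> where "\<beta> = of_real (sqrt \<eta>) * a"
  have "((\<lambda>q. complex_of_real ((cmod (mixed_ket \<eta> a l i q))\<^sup>2)) has_sum
      of_real (\<Sum>r\<le>l. binomial_weight \<eta> l r * (cmod (displacement \<beta> i r))\<^sup>2)) UNIV"
    using mixed_ket_overlap[OF \<eta>, of a l i i] by (simp add: complex_norm_square \<beta>_def del: of_real_power)
  then have *: "((\<lambda>q. (cmod (mixed_ket \<eta> a l i q))\<^sup>2) has_sum
      (\<Sum>r\<le>l. binomial_weight \<eta> l r * (cmod (displacement \<beta> i r))\<^sup>2)) UNIV"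
    unfolding has_sum_of_real_iff .
  then show "l2 (mixed_ket \<eta> a l i)" by (rule has_sum_imp_summable)
  have "(\<Sum>r\<le>l. binomial_weight \<eta> l r * (cmod (displacement \<beta> i r))\<^sup>2) \<le> (\<Sum>r\<le>l. binomial_weight \<eta> l r * 1)"
    by (intro sum_mono mult_left_mono binomial_weight_nonneg \<eta>)
      (simp add: power_le_one unitary_op_entry_le_1[OF unitary_displacement])
  then show "(\<Sum>\<^sub>\<infinity>q. (cmod (mixed_ket \<eta> a l i q))\<^sup>2) \<le> 1"
    unfolding infsumI[OF *] by (simp add: binomial_weight_sum)
qed

lemma thermal_state_eq: "thermal_state N = op_diag (\<lambda>n. of_real (thermal_weight N n))"
  by (simp add: thermal_state_def thermal_weight_def)

text \<open>Photon conservation leaves one term for each l. The scalar \<open>c\<close> is carried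
  because fixing the idler indices produces multiples of a coherent state.\<close>

lemma beamsplitter_conjugate_coherent:
  "op_conjugate (beamsplitter \<eta>) (op_tensor (\<lambda>m n. c * coherent_state a m n) (thermal_state N)) (i, q) (j, q') =
     (\<Sum>\<^sub>\<infinity>l. of_real (thermal_weight N l) * (c * (mixed_ket \<eta> a l i q * cnj (mixed_ket \<eta> a l j q'))))"
proof -
  define A where "A = op_tensor (\<lambda>m n. c * coherent_state a m n) (thermal_state N)"
  have 1: "op_mult A (op_adj (beamsplitter \<eta>)) (n, m) (j, q') =
      c * coherent_ket a n * of_real (thermal_weight N m) * cnj (mixed_ket \<eta> a m j q')" for n m
  proof -
    have "op_mult A (op_adj (beamsplitter \<eta>)) (n, m) (j, q') =
        A (n, m) (j + q' - m, m) * op_adj (beamsplitter \<eta>) (j + q' - m, m) (j, q')"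
      unfolding op_mult_def
      by (rule infsum_single_support)
        (auto simp: A_def op_tensor_def thermal_state_def op_diag_def op_adj_def beamsplitter_def split: prod.splits)
    then show ?thesis
      by (simp add: A_def op_tensor_def coherent_state_def thermal_state_eq op_diag_def op_adj_def mixed_ket_def mult_ac)
  qed
  define g where "g = (\<lambda>(n, m). beamsplitter \<eta> (i, q) (n, m) *
      (c * coherent_ket a n * of_real (thermal_weight N m) * cnj (mixed_ket \<eta> a m j q')))"
  have "op_conjugate (beamsplitter \<eta>) A (i, q) (j, q') =
      (\<Sum>\<^sub>\<infinity>k. beamsplitter \<eta> (i, q) k * op_mult A (op_adj (beamsplitter \<eta>)) k (j, q'))"
    by (simp add: op_conjugate_def op_mult_def[of "beamsplitter \<eta>"])
  also have "\<dots> = infsum g UNIV"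
    by (rule infsum_cong) (auto simp: g_def 1)
  \<comment> \<open>Photon conservation confines \<open>g\<close> to \<open>n + m = i + q\<close>.
    The curve also contains points \<open>(0, l)\<close> with \<open>l > i + q\<close>, where
    \<open>g\<close> is 0.\<close>
  also have "\<dots> = infsum g (range (\<lambda>l. (i + q - l, l)))"
  proof (rule infsum_cong_neutral)
    show "g x = 0" if "x \<in> UNIV - range (\<lambda>l. (i + q - l, l))" for x
    proof -
      obtain n m where x: "x = (n, m)" by fastforce
      have "i + q \<noteq> n + m"
      proof
        assume "i + q = n + m"
        then have "x = (\<lambda>l. (i + q - l, l)) m" by (simp add: x)
        with that show False by blast
      qed
      then show ?thesis by (simp add: g_def x beamsplitter_def)
    qed
  qed auto
  also have "\<dots> = (\<Sum>\<^sub>\<infinity>l. g (i + q - l, l))"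
    by (subst infsum_reindex) (auto simp: inj_on_def o_def)
  also have "\<dots> = (\<Sum>\<^sub>\<infinity>l. of_real (thermal_weight N l) * (c * (mixed_ket \<eta> a l i q * cnj (mixed_ket \<eta> a l j q'))))"
    by (simp add: g_def mixed_ket_def[of _ _ _ i q] mult_ac)
  finally show ?thesis by (simp add: A_def)
qed

text \<open>Summing over q first produces the overlaps of \<open>mixed_ket_overlap\<close>, in which
  the displacement of the lost mode is gone. Exchanging l and r then leaves, for each r, the sum
  evaluated by \<open>thermal_weight_thinning\<close>.\<close>

lemma bosonic_channel_coherent:
  assumes \<eta>: "0 < \<eta>" "\<eta> < 1" and N: "0 < N"
  shows "bosonic_channel \<eta> N (\<lambda>m n. c * coherent_state a m n) i j =
    c * op_conjugate (displacement (of_real (sqrt \<eta>) * a)) (thermal_state ((1 - \<eta>) * N)) i j"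
proof -
  define \<beta> where "\<beta> = of_real (sqrt \<eta>) * a"
  define t where "t l = complex_of_real (thermal_weight N l)" for l
  define D where "D r = displacement \<beta> i r * cnj (displacement \<beta> j r)" for r
  have t: "l1 t"
    using has_sum_imp_summable[OF thermal_weight_has_sum[OF N]] thermal_weight_nonneg[OF N]
    by (simp add: t_def)
  have D: "cmod (D r) \<le> 1" for r
    unfolding D_def norm_mult complex_mod_cnj
    by (intro mult_le_one unitary_op_entry_le_1 unitary_displacement) simp
  have fin: "((\<lambda>r. of_real (binomial_weight \<eta> l r) * f r) has_sum (\<Sum>r\<le>l. of_real (binomial_weight \<eta> l r) * f r)) UNIV"
    for l and f :: "nat \<Rightarrow> complex"
    by (rule has_sum_finite_neutralI) (auto simp: binomial_weight_eq_0)
  have fin': "((\<lambda>r. cmod (of_real (binomial_weight \<eta> l r) * f r)) has_sum (\<Sum>r\<le>l. cmod (of_real (binomial_weight \<eta> l r) * f r))) UNIV"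
    for l and f :: "nat \<Rightarrow> complex"
    by (rule has_sum_finite_neutralI) (auto simp: binomial_weight_eq_0)
  have "bosonic_channel \<eta> N (\<lambda>m n. c * coherent_state a m n) i j =
      (\<Sum>\<^sub>\<infinity>q. \<Sum>\<^sub>\<infinity>l. t l * (c * (mixed_ket \<eta> a l i q * cnj (mixed_ket \<eta> a l j q))))"
    by (simp add: bosonic_channel_def partial_trace_snd_def beamsplitter_conjugate_coherent t_def)
  also have "\<dots> = (\<Sum>\<^sub>\<infinity>l. t l * (\<Sum>\<^sub>\<infinity>q. c * (mixed_ket \<eta> a l i q * cnj (mixed_ket \<eta> a l j q))))"
  proof (rule infsum_swap_weighted[OF t, where C = "cmod c * 2"])
    fix l
    show "l1 (\<lambda>q. c * (mixed_ket \<eta> a l i q * cnj (mixed_ket \<eta> a l j q)))"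
      by (subst norm_mult) (intro summable_on_cmult_right l2_mult_abs_summable l2_cnj mixed_ket_l2 \<eta>)
    have "(\<Sum>\<^sub>\<infinity>q. cmod (mixed_ket \<eta> a l i q * cnj (mixed_ket \<eta> a l j q))) \<le> 2"
      using l2_mult_bound[OF mixed_ket_l2(1)[OF \<eta>, of a l i] l2_cnj[OF mixed_ket_l2(1)[OF \<eta>, of a l j]]]
        mixed_ket_l2(2)[OF \<eta>, of a l i] mixed_ket_l2(2)[OF \<eta>, of a l j] by simp
    then show "(\<Sum>\<^sub>\<infinity>q. cmod (c * (mixed_ket \<eta> a l i q * cnj (mixed_ket \<eta> a l j q)))) \<le> cmod c * 2"
      by (subst norm_mult) (simp only: infsum_cmult_right' mult_left_mono norm_ge_zero)
  qed
  also have "\<dots> = c * (\<Sum>\<^sub>\<infinity>l. t l * (\<Sum>r\<le>l. of_real (binomial_weight \<eta> l r) * D r))"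
    unfolding infsum_cmult_right' infsumI[OF mixed_ket_overlap[OF \<eta>]] D_def \<beta>_def
    by (simp add: infsum_cmult_right' mult.left_commute[of _ c])
  also have "(\<Sum>\<^sub>\<infinity>l. t l * (\<Sum>r\<le>l. of_real (binomial_weight \<eta> l r) * D r)) =
      (\<Sum>\<^sub>\<infinity>l. t l * (\<Sum>\<^sub>\<infinity>r. of_real (binomial_weight \<eta> l r) * D r))"
    by (simp only: infsumI[OF fin])
  also have "\<dots> = (\<Sum>\<^sub>\<infinity>r. \<Sum>\<^sub>\<infinity>l. t l * (of_real (binomial_weight \<eta> l r) * D r))"
  proof (rule infsum_swap_weighted[OF t, symmetric])
    fix l
    show "l1 (\<lambda>r. of_real (binomial_weight \<eta> l r) * D r)"
      using fin' by (rule has_sum_imp_summable)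
    have "(\<Sum>r\<le>l. cmod (of_real (binomial_weight \<eta> l r) * D r)) \<le> (\<Sum>r\<le>l. binomial_weight \<eta> l r * 1)"
      unfolding norm_mult using D binomial_weight_nonneg[OF \<eta>] by (intro sum_mono mult_mono) auto
    then show "(\<Sum>\<^sub>\<infinity>r. cmod (of_real (binomial_weight \<eta> l r) * D r)) \<le> 1"
      unfolding infsumI[OF fin'] by (simp add: binomial_weight_sum)
  qed
  also have "\<dots> = (\<Sum>\<^sub>\<infinity>r. of_real (thermal_weight ((1 - \<eta>) * N) r) * D r)"
  proof (rule infsum_cong)
    fix r
    have "(\<Sum>\<^sub>\<infinity>l. t l * (of_real (binomial_weight \<eta> l r) * D r)) =
        (\<Sum>\<^sub>\<infinity>l. complex_of_real (thermal_weight N l * binomial_weight \<eta> l r)) * D r"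
      unfolding infsum_cmult_left'[symmetric] by (simp add: t_def mult_ac)
    also have "(\<Sum>\<^sub>\<infinity>l. complex_of_real (thermal_weight N l * binomial_weight \<eta> l r)) =
        of_real (thermal_weight ((1 - \<eta>) * N) r)"
      by (rule infsumI) (rule has_sum_of_real, rule thermal_weight_thinning[OF N \<eta>])
    finally show "(\<Sum>\<^sub>\<infinity>l. t l * (of_real (binomial_weight \<eta> l r) * D r)) =
        of_real (thermal_weight ((1 - \<eta>) * N) r) * D r" .
  qed
  finally show ?thesis
    by (simp add: thermal_state_eq op_conjugate_diag D_def \<beta>_def mult_ac)
qed


subsection \<open>The output states\<close>

lemma op_conjugate_diag_left:
  "op_conjugate (op_diag d) X i j = d i * X i j * cnj (d j)"
proof -
  have 1: "op_mult X (op_adj (op_diag d)) k j = X k j * cnj (d j)" for k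
    unfolding op_mult_def op_adj_def op_diag_def by (subst infsum_single_support[of j]) auto
  show ?thesis
    unfolding op_conjugate_def op_mult_def[of "op_diag d"] 1
    by (subst infsum_single_support[of i]) (auto simp: op_diag_def)
qed

text \<open>Each block with fixed idler indices is a coherent state times the scalar
  \<open>G k l\<close>, and the phase shift merely rotates its amplitude, so the channel result
  applies blockwise.\<close>

lemma output_state_split_coherent:
  assumes \<eta>: "0 < \<eta>" "\<eta> < 1" and N: "0 < N"
  shows "output_state \<eta> N (split_coherent_state \<tau> \<alpha>) \<theta> =
    op_tensor (op_conjugate (displacement (exp (\<i> * of_real \<theta>) * (of_real (sqrt (\<eta> * \<tau>)) * \<alpha>)))
        (thermal_state ((1 - \<eta>) * N)))
      (coherent_state (of_real (sqrt (1 - \<tau>)) * \<alpha>))"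
proof (intro ext, clarify)
  fix i k j l
  define a where "a = of_real (sqrt \<tau>) * \<alpha>"
  define G where "G = coherent_state (of_real (sqrt (1 - \<tau>)) * \<alpha>)"
  define b where "b = exp (\<i> * of_real \<theta>) * a"
  have ket: "coherent_ket b n = exp (\<i> * of_real \<theta> * of_nat n) * coherent_ket a n" for n
    by (simp add: coherent_ket_def b_def norm_mult power_mult_distrib exp_of_nat2_mult)
  have phase: "map_tensor_id (op_conjugate (phase_unitary \<theta>)) (split_coherent_state \<tau> \<alpha>) (m, k) (n, l) =
      G k l * coherent_state b m n" for m n
    unfolding split_coherent_state_def a_def[symmetric] G_def[symmetric]
    by (simp add: map_tensor_id_def phase_unitary_def op_conjugate_diag_left op_tensor_def
        coherent_state_def[of a] coherent_state_def[of b] ket mult_ac)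
  have "output_state \<eta> N (split_coherent_state \<tau> \<alpha>) \<theta> (i, k) (j, l) =
      bosonic_channel \<eta> N (\<lambda>m n. G k l * coherent_state b m n) i j"
    unfolding output_state_def map_tensor_id_def[of "bosonic_channel \<eta> N"] by (simp add: phase)
  also have "\<dots> = G k l * op_conjugate (displacement (of_real (sqrt \<eta>) * b))
      (thermal_state ((1 - \<eta>) * N)) i j"
    by (rule bosonic_channel_coherent[OF \<eta> N])
  also have "of_real (sqrt \<eta>) * b = exp (\<i> * of_real \<theta>) * (of_real (sqrt (\<eta> * \<tau>)) * \<alpha>)"
    by (simp add: a_def b_def real_sqrt_mult)
  finally show "output_state \<eta> N (split_coherent_state \<tau> \<alpha>) \<theta> (i, k) (j, l) =
      op_tensor (op_conjugate (displacement (exp (\<i> * of_real \<theta>) * (of_real (sqrt (\<eta> * \<tau>)) * \<alpha>)))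
        (thermal_state ((1 - \<eta>) * N)))
      (coherent_state (of_real (sqrt (1 - \<tau>)) * \<alpha>)) (i, k) (j, l)"
    by (simp add: op_tensor_def G_def)
qed

lemma infsum_snd_0:
  fixes f :: "'a \<times> nat \<Rightarrow> 'b::{comm_monoid_add, t2_space}"
  assumes "\<And>r s. s \<noteq> 0 \<Longrightarrow> f (r, s) = 0"
  shows "infsum f UNIV = (\<Sum>\<^sub>\<infinity>r. f (r, 0))"
proof -
  have "infsum f UNIV = infsum f (range (\<lambda>r. (r, 0)))"
  proof (rule infsum_cong_neutral)
    show "f x = 0" if "x \<in> UNIV - range (\<lambda>r. (r, 0))" for x
      using that assms by (metis DiffD2 rangeI surj_pair)
  qed auto
  then show ?thesis by (subst (asm) infsum_reindex) (auto simp: inj_on_def o_def)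
qed

text \<open>\<open>D(\<gamma>)\<close> maps the vacuum to the coherent state, so it completes the pure idler state to a basis.\<close>

lemma vn_entropy_tensor_coherent:
  assumes V: "unitary_op V" and p: "(p has_sum 1) UNIV" "\<And>r. 0 \<le> p r"
  shows "vn_entropy (op_tensor (op_conjugate V (op_diag (\<lambda>r. complex_of_real (p r)))) (coherent_state \<gamma>)) =
    (\<Sum>\<^sub>\<infinity>r. ennreal (- (p r * ln (p r))))"
proof -
  define q where "q = (\<lambda>(r, s::nat). if s = 0 then p r else 0)"
  define W where "W = op_tensor V (displacement \<gamma>)"
  have "(q has_sum 1) UNIV"
  proof -
    have "(q has_sum 1) (range (\<lambda>r. (r, 0)))"
      using p by (subst has_sum_reindex) (auto simp: inj_on_def o_def q_def)
    then show ?thesis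
      by (subst has_sum_cong_neutral[where T = "range (\<lambda>r. (r, 0))"]) (auto simp: q_def)
  qed
  moreover have "op_tensor (op_conjugate V (op_diag (\<lambda>r. complex_of_real (p r)))) (coherent_state \<gamma>) (i, k) (j, l) =
      op_conjugate W (op_diag (\<lambda>x. complex_of_real (q x))) (i, k) (j, l)" for i k j l
  proof -
    have "op_conjugate W (op_diag (\<lambda>x. complex_of_real (q x))) (i, k) (j, l) =
        (\<Sum>\<^sub>\<infinity>r. (V i r * of_real (p r) * cnj (V j r)) * coherent_state \<gamma> k l)"
      unfolding op_conjugate_diag
      by (subst infsum_snd_0)
        (auto simp: W_def op_tensor_def q_def displacement_0_right coherent_state_def mult_ac)
    then show ?thesis by (simp add: infsum_cmult_left' op_tensor_def op_conjugate_diag)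
  qed
  ultimately have "spectral_decomposition
      (op_tensor (op_conjugate V (op_diag (\<lambda>r. complex_of_real (p r)))) (coherent_state \<gamma>)) W q"
    using p V by (auto simp: spectral_decomposition_def W_def q_def fun_eq_iff
        intro!: unitary_tensor unitary_displacement)
  from vn_entropy_eq[OF this] show ?thesis
    by (subst (asm) infsum_snd_0) (auto simp: q_def)
qed

text \<open>The logarithm of a geometric weight is affine in r, so mass and mean determine the
  entropy. For the phase average an inequality takes the place of this equality.\<close>

lemma thermal_entropy:
  assumes "0 < N"
  shows "(\<Sum>\<^sub>\<infinity>r. ennreal (- (thermal_weight N r * ln (thermal_weight N r)))) =
    ennreal (N * ln ((N + 1) / N) + ln (N + 1))"
proof -
  have ln: "- (thermal_weight N r * ln (thermal_weight N r)) =
      ln ((N + 1) / N) * (real r * thermal_weight N r) + ln (N + 1) * thermal_weight N r" for r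
  proof -
    have *: "ln (thermal_weight N r) = - real r * ln ((N + 1) / N) - ln (N + 1)"
      using assms by (simp add: thermal_weight_geometric ln_mult ln_div ln_realpow algebra_simps)
    show ?thesis unfolding * by (simp add: algebra_simps)
  qed
  have "((\<lambda>r. - (thermal_weight N r * ln (thermal_weight N r))) has_sum
      (ln ((N + 1) / N) * N + ln (N + 1) * 1)) UNIV"
    unfolding ln by (intro has_sum_add has_sum_cmult_right thermal_weight_mean thermal_weight_has_sum assms)
  moreover have "0 \<le> - (thermal_weight N r * ln (thermal_weight N r))" for r
    unfolding ln using assms by (intro add_nonneg_nonneg mult_nonneg_nonneg) (auto simp: thermal_weight_nonneg)
  ultimately show ?thesis
    by (simp add: infsum_ennreal_of_real[OF has_sum_imp_summable] infsumI mult.commute)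
qed

lemma vn_entropy_output_state:
  assumes \<eta>: "0 < \<eta>" "\<eta> < 1" and N: "0 < N"
  defines "M \<equiv> (1 - \<eta>) * N"
  shows "vn_entropy (output_state \<eta> N (split_coherent_state \<tau> \<alpha>) \<theta>) =
    ennreal (M * ln ((M + 1) / M) + ln (M + 1))"
proof -
  have M: "0 < M" using assms by (simp add: M_def)
  show ?thesis
    unfolding output_state_split_coherent[OF \<eta> N] M_def[symmetric] thermal_state_eq thermal_entropy[OF M, symmetric]
    by (rule vn_entropy_tensor_coherent[OF unitary_displacement thermal_weight_has_sum[OF M] thermal_weight_nonneg[OF M]])
qed

subsection \<open>The phase-averaged displaced thermal state\<close>

lemma thermal_displacement_has_sum:
  assumes N: "0 < N"
  shows "((\<lambda>r. of_real (thermal_weight N r) * (displacement \<beta> i r * cnj (displacement \<beta> j r))) has_sum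
    op_conjugate (displacement \<beta>) (thermal_state N) i j) UNIV"
proof -
  have "l1 (\<lambda>r. of_real (thermal_weight N r) * (displacement \<beta> i r * cnj (displacement \<beta> j r)))"
  proof (rule Infinite_Sum.abs_summable_on_comparison_test')
    show "thermal_weight N summable_on UNIV"
      using thermal_weight_has_sum[OF N] by (rule has_sum_imp_summable)
    fix r
    have "cmod (displacement \<beta> i r * cnj (displacement \<beta> j r)) \<le> 1"
      unfolding norm_mult complex_mod_cnj
      by (intro mult_le_one unitary_op_entry_le_1 unitary_displacement) simp
    then have "thermal_weight N r * cmod (displacement \<beta> i r * cnj (displacement \<beta> j r)) \<le> thermal_weight N r * 1"
      by (intro mult_left_mono thermal_weight_nonneg N)
    then show "cmod (of_real (thermal_weight N r) * (displacement \<beta> i r * cnj (displacement \<beta> j r))) \<le> thermal_weight N r"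
      using thermal_weight_nonneg[OF N, of r] by (simp add: norm_mult)
  qed
  from abs_summable_summable[OF this] show ?thesis
    by (simp add: has_sum_iff thermal_state_eq op_conjugate_diag mult_ac)
qed

text \<open>Operator form with \<open>q = N / (N + 1)\<close>:
  \<open>a M = \<beta> (1 - q) M + q M a\<close>. It follows from a D = D (a + \<beta>), a T = q T a
  and the adjoint rule for the right factor.\<close>

lemma thermal_displacement_Suc:
  fixes \<beta> :: complex
  assumes N: "0 < N"
  defines "M \<equiv> op_conjugate (displacement \<beta>) (thermal_state N)"
  shows "of_real (sqrt (real (Suc i))) * M (Suc i) j =
    \<beta> / of_real (N + 1) * M i j + of_real (N / (N + 1)) * of_real (sqrt (real j)) * M i (j - 1)"
proof -
  define D where "D = displacement \<beta>"
  define t where "t r = complex_of_real (thermal_weight N r)" for r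
  define q where "q = complex_of_real (N / (N + 1))"
  have M: "((\<lambda>r. t r * (D i r * cnj (D j r))) has_sum M i j) UNIV" for i j
    unfolding D_def t_def M_def by (rule thermal_displacement_has_sum[OF N])
  note M' = infsumI[OF M] has_sum_imp_summable[OF M]
  have t_Suc: "t (Suc r) = q * t r" for r
    unfolding t_def q_def thermal_weight_Suc by simp
  have "of_real (sqrt (real (Suc i))) * M (Suc i) j - \<beta> * M i j =
      (\<Sum>\<^sub>\<infinity>r. of_real (sqrt (real (Suc i))) * (t r * (D (Suc i) r * cnj (D j r))) + - \<beta> * (t r * (D i r * cnj (D j r))))"
    by (subst infsum_add) (simp_all only: infsum_cmult_right' M' summable_on_cmult_right, simp)
  also have "\<dots> = (\<Sum>\<^sub>\<infinity>r. t r * (of_real (sqrt (real r)) * D i (r - 1) * cnj (D j r)))"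
  proof (rule infsum_cong)
    fix r
    have *: "of_real (sqrt (real r)) * D i (r - 1) = of_real (sqrt (real (Suc i))) * D (Suc i) r - \<beta> * D i r"
      unfolding D_def displacement_Suc_left by simp
    show "of_real (sqrt (real (Suc i))) * (t r * (D (Suc i) r * cnj (D j r))) + - \<beta> * (t r * (D i r * cnj (D j r))) =
        t r * (of_real (sqrt (real r)) * D i (r - 1) * cnj (D j r))"
      unfolding * by (simp add: algebra_simps del: of_nat_Suc)
  qed
  also have "\<dots> = (\<Sum>\<^sub>\<infinity>r. q * (t r * (D i r * cnj (of_real (sqrt (real (Suc r))) * D j (Suc r)))))"
    by (subst infsum_Suc) (simp_all add: t_Suc mult_ac del: of_nat_Suc)
  also have "\<dots> = (\<Sum>\<^sub>\<infinity>r. (- q * \<beta>) * (t r * (D i r * cnj (D j r))) +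
      (q * of_real (sqrt (real j))) * (t r * (D i r * cnj (D (j - 1) r))))"
    unfolding D_def displacement_Suc_right by (simp add: algebra_simps)
  also have "\<dots> = (- q * \<beta>) * M i j + (q * of_real (sqrt (real j))) * M i (j - 1)"
    by (subst infsum_add) (simp_all only: infsum_cmult_right' M' summable_on_cmult_right)
  finally have "of_real (sqrt (real (Suc i))) * M (Suc i) j =
      \<beta> * (1 - q) * M i j + q * of_real (sqrt (real j)) * M i (j - 1)"
    by (simp add: algebra_simps del: of_nat_Suc)
  also have "1 - q = 1 / of_real (N + 1)"
  proof -
    have "1 - N / (N + 1) = 1 / (N + 1)" using N by (simp add: field_simps)
    then show ?thesis unfolding q_def by (metis of_real_1 of_real_diff of_real_divide)
  qed
  finally show ?thesis by (simp add: q_def)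
qed

text \<open>The vacuum overlaps are Poissonian, so with \<open>q = N / (N + 1)\<close> the mixture
  is an exponential series with total exponent \<open>- S + q * S = - S / (N + 1)\<close>.\<close>

lemma thermal_displacement_0_0:
  assumes N: "0 < N"
  shows "op_conjugate (displacement \<beta>) (thermal_state N) 0 0 = of_real (exp (- (cmod \<beta>)\<^sup>2 / (N + 1)) / (N + 1))"
proof -
  define S where "S = (cmod \<beta>)\<^sup>2"
  define q where "q = N / (N + 1)"
  have "of_real (thermal_weight N r) * (displacement \<beta> 0 r * cnj (displacement \<beta> 0 r)) =
      complex_of_real ((exp (- S) / (N + 1)) * ((q * S) ^ r /\<^sub>R fact r))" for r
  proof -
    have "(exp (- S / 2))\<^sup>2 = exp (- S)" by (simp add: exp_double[symmetric])
    then have "(cmod (displacement \<beta> 0 r))\<^sup>2 = exp (- S) * S ^ r / fact r"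
      by (simp add: displacement_0_left coherent_ket_def norm_mult norm_divide norm_power S_def
          power_mult_distrib power_divide flip: power_mult) (simp add: mult.commute)
    then have 1: "displacement \<beta> 0 r * cnj (displacement \<beta> 0 r) = of_real (exp (- S) * S ^ r / fact r)"
      by (metis complex_norm_square)
    have 2: "thermal_weight N r * (exp (- S) * S ^ r / fact r) = (exp (- S) / (N + 1)) * ((q * S) ^ r /\<^sub>R fact r)"
      by (simp add: thermal_weight_geometric q_def power_mult_distrib divide_inverse mult_ac)
    show ?thesis unfolding 1 of_real_mult[symmetric] 2 ..
  qed
  note * = thermal_displacement_has_sum[OF N, of \<beta> 0 0, unfolded this]
  have "(\<lambda>r. (exp (- S) / (N + 1)) * ((q * S) ^ r /\<^sub>R fact r)) sums ((exp (- S) / (N + 1)) * exp (q * S))"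
    by (intro sums_mult exp_converges)
  then have "((\<lambda>r. (exp (- S) / (N + 1)) * ((q * S) ^ r /\<^sub>R fact r)) has_sum ((exp (- S) / (N + 1)) * exp (q * S))) UNIV"
    by (rule sums_nonneg_imp_has_sum) (use N in \<open>auto simp: q_def S_def\<close>)
  then have "((\<lambda>r. complex_of_real ((exp (- S) / (N + 1)) * ((q * S) ^ r /\<^sub>R fact r))) has_sum
      of_real ((exp (- S) / (N + 1)) * exp (q * S))) UNIV"
    by (rule has_sum_of_real)
  from has_sum_unique[OF * this]
  have "op_conjugate (displacement \<beta>) (thermal_state N) 0 0 = of_real ((exp (- S) / (N + 1)) * exp (q * S))" .
  also have "(exp (- S) / (N + 1)) * exp (q * S) = exp (- S + q * S) / (N + 1)"
    by (simp only: exp_add) simp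
  also have "- S + q * S = - S / (N + 1)" using N by (simp add: q_def field_simps)
  finally show ?thesis by (simp only: S_def)
qed

text \<open>Normal ordering of the displaced thermal state; the parameters are read off by comparing
  \<open>thermal_displacement_Suc\<close> with \<open>kernel_Suc_left\<close>. On the diagonal it
  replaces an infinite mixture by a finite sum of nonnegative terms. Row 0 is reached from column 0
  by Hermitian symmetry.\<close>

lemma thermal_displacement_kernel:
  fixes \<beta> :: complex
  assumes N: "0 < N"
  defines "b \<equiv> \<beta> / of_real (N + 1)"
  shows "op_conjugate (displacement \<beta>) (thermal_state N) i j =
    of_real (exp (- (cmod \<beta>)\<^sup>2 / (N + 1)) / (N + 1)) * kernel b (cnj b) (of_real (N / (N + 1))) i j"
proof -
  define M where "M = op_conjugate (displacement \<beta>) (thermal_state N)"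
  define q where "q = complex_of_real (N / (N + 1))"
  define K where "K i j = of_real (exp (- (cmod \<beta>)\<^sup>2 / (N + 1)) / (N + 1)) * kernel b (cnj b) q i j" for i j
  have M_Suc: "of_real (sqrt (real (Suc i))) * M (Suc i) j =
      b * M i j + q * of_real (sqrt (real j)) * M i (j - 1)" for i j
    unfolding M_def b_def q_def by (rule thermal_displacement_Suc[OF N])
  have K_Suc: "of_real (sqrt (real (Suc i))) * K (Suc i) j =
      b * K i j + q * of_real (sqrt (real j)) * K i (j - 1)" for i j
    using arg_cong[OF kernel_Suc_left[of i b "cnj b" q j],
        of "\<lambda>x. of_real (exp (- (cmod \<beta>)\<^sup>2 / (N + 1)) / (N + 1)) * x"]
    unfolding K_def by (simp only: distrib_left mult_ac)
  have cnj_q: "cnj q = q" by (simp add: q_def)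
  have cnj_K: "cnj (K j i) = K i j" for i j
    unfolding K_def complex_cnj_mult kernel_cnj cnj_q
    by (simp add: kernel_commute[of b "cnj b"])
  have cnj_M: "cnj (M j i) = M i j" for i j
    unfolding M_def thermal_state_eq op_conjugate_diag infsum_cnj[symmetric] by (simp add: mult_ac)
  have col: "M i 0 = K i 0" for i
  proof (induction i)
    case 0
    have "kernel b (cnj b) q 0 0 = 1" by (simp add: kernel_def)
    then show ?case unfolding M_def thermal_displacement_0_0[OF N] by (simp add: K_def)
  next
    case (Suc i)
    have "of_real (sqrt (real (Suc i))) * M (Suc i) 0 = of_real (sqrt (real (Suc i))) * K (Suc i) 0"
      unfolding M_Suc K_Suc Suc.IH by simp
    then show ?case by (simp del: of_nat_Suc)
  qed
  have "M i j = K i j" for i j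
  proof (induction i arbitrary: j)
    case 0
    show ?case using col[of j] cnj_M[of j 0] cnj_K[of j 0] by metis
  next
    case (Suc i)
    have "of_real (sqrt (real (Suc i))) * M (Suc i) j = of_real (sqrt (real (Suc i))) * K (Suc i) j"
      unfolding M_Suc K_Suc Suc.IH ..
    then show ?case by (simp del: of_nat_Suc)
  qed
  then show ?thesis by (simp only: M_def K_def q_def)
qed

text \<open>The photon number distribution of the displaced thermal state, written as a mixture over
  r. This form gives mass and mean by \<open>has_sum_Tonelli\<close>; the pointwise bound comes from
  \<open>thermal_displacement_kernel\<close>.\<close>

definition ring_weight :: "real \<Rightarrow> complex \<Rightarrow> nat \<Rightarrow> real" where
  "ring_weight N \<beta> i = (\<Sum>\<^sub>\<infinity>r. thermal_weight N r * (cmod (displacement \<beta> i r))\<^sup>2)"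

lemma displacement_column_has_sum:
  "((\<lambda>i. (cmod (displacement \<beta> i r))\<^sup>2) has_sum 1) UNIV"
  by (rule unitary_op_column_norm[OF unitary_displacement])

lemma ring_weight_nonneg: "0 < N \<Longrightarrow> 0 \<le> ring_weight N \<beta> i"
  unfolding ring_weight_def by (intro infsum_nonneg mult_nonneg_nonneg thermal_weight_nonneg) auto

lemma ring_weight_summable:
  assumes N: "0 < N"
  shows "(\<lambda>r. thermal_weight N r * (cmod (displacement \<beta> i r))\<^sup>2) summable_on UNIV"
proof (rule has_sum_Tonelli(1)[where f = "\<lambda>r i. thermal_weight N r * (cmod (displacement \<beta> i r))\<^sup>2"])
  show "((\<lambda>i. thermal_weight N r * (cmod (displacement \<beta> i r))\<^sup>2) has_sum thermal_weight N r * 1) UNIV" for r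
    by (intro has_sum_cmult_right displacement_column_has_sum)
  show "((\<lambda>r. thermal_weight N r * 1) has_sum 1) UNIV"
    using thermal_weight_has_sum[OF N] by simp
qed (use thermal_weight_nonneg[OF N] in auto)

lemma ring_weight_has_sum:
  assumes N: "0 < N"
  shows "(ring_weight N \<beta> has_sum 1) UNIV"
proof -
  have "((\<lambda>i. \<Sum>\<^sub>\<infinity>r. thermal_weight N r * (cmod (displacement \<beta> i r))\<^sup>2) has_sum 1) UNIV"
  proof (rule has_sum_Tonelli(2))
    show "((\<lambda>i. thermal_weight N r * (cmod (displacement \<beta> i r))\<^sup>2) has_sum thermal_weight N r * 1) UNIV" for r
      by (intro has_sum_cmult_right displacement_column_has_sum)
    show "((\<lambda>r. thermal_weight N r * 1) has_sum 1) UNIV"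
      using thermal_weight_has_sum[OF N] by simp
  qed (use thermal_weight_nonneg[OF N] in auto)
  then show ?thesis by (simp add: ring_weight_def[abs_def])
qed

text \<open>The mean is the squared norm of the annihilation operator applied to column r, that is
  of \<beta> times column r plus \<open>sqrt (real r)\<close> times column \<open>r - 1\<close>;
  orthonormality removes the cross terms.\<close>

lemma displacement_mean:
  "((\<lambda>i. real i * (cmod (displacement \<beta> i r))\<^sup>2) has_sum (real r + (cmod \<beta>)\<^sup>2)) UNIV"
proof -
  define D where "D = displacement \<beta>"
  define s where "s = complex_of_real (sqrt (real r))"
  define G where "G i j = (if i = j then 1 else (0::complex))" for i j :: nat
  have G: "((\<lambda>m. D m i * cnj (D m j)) has_sum G i j) UNIV" for i j
    unfolding D_def G_def by (rule displacement_Gram_has_sum)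
  have "((\<lambda>i. \<beta> * cnj \<beta> * (D i r * cnj (D i r)) + \<beta> * s * (D i r * cnj (D i (r - 1))) +
      s * cnj \<beta> * (D i (r - 1) * cnj (D i r)) + s * s * (D i (r - 1) * cnj (D i (r - 1)))) has_sum
      (\<beta> * cnj \<beta> * G r r + \<beta> * s * G r (r - 1) + s * cnj \<beta> * G (r - 1) r + s * s * G (r - 1) (r - 1))) UNIV"
    by (intro has_sum_add has_sum_cmult_right G)
  also have "\<beta> * cnj \<beta> * G r r + \<beta> * s * G r (r - 1) + s * cnj \<beta> * G (r - 1) r + s * s * G (r - 1) (r - 1) =
      of_real (real r + (cmod \<beta>)\<^sup>2)"
  proof -
    have "s * s = of_real (real r)" unfolding s_def of_real_mult[symmetric] by simp
    then have 1: "s * s * G (r - 1) (r - 1) = of_real (real r)" by (simp add: G_def)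
    \<comment> \<open>For \<open>r = 0\<close> the columns r and \<open>r - 1\<close> coincide, but
      then the factor \<open>s\<close> is 0.\<close>
    have 2: "\<beta> * s * G r (r - 1) = 0" "s * cnj \<beta> * G (r - 1) r = 0" by (cases r; simp add: G_def s_def)+
    have 3: "\<beta> * cnj \<beta> * G r r = of_real ((cmod \<beta>)\<^sup>2)"
      by (simp add: G_def complex_norm_square del: of_real_power)
    show ?thesis unfolding 1 2 3 by simp
  qed
  also have "(\<lambda>i. \<beta> * cnj \<beta> * (D i r * cnj (D i r)) + \<beta> * s * (D i r * cnj (D i (r - 1))) +
      s * cnj \<beta> * (D i (r - 1) * cnj (D i r)) + s * s * (D i (r - 1) * cnj (D i (r - 1)))) =
      (\<lambda>i. complex_of_real (real (Suc i) * (cmod (D (Suc i) r))\<^sup>2))"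
  proof
    fix i
    have "complex_of_real (real (Suc i) * (cmod (D (Suc i) r))\<^sup>2) =
        complex_of_real ((cmod (of_real (sqrt (real (Suc i))) * D (Suc i) r))\<^sup>2)"
      by (simp add: norm_mult power_mult_distrib del: of_nat_Suc)
    also have "of_real (sqrt (real (Suc i))) * D (Suc i) r = \<beta> * D i r + s * D i (r - 1)"
      unfolding D_def s_def by (rule displacement_Suc_left)
    also have "complex_of_real ((cmod (\<beta> * D i r + s * D i (r - 1)))\<^sup>2) =
        \<beta> * cnj \<beta> * (D i r * cnj (D i r)) + \<beta> * s * (D i r * cnj (D i (r - 1))) +
        s * cnj \<beta> * (D i (r - 1) * cnj (D i r)) + s * s * (D i (r - 1) * cnj (D i (r - 1)))"
      unfolding complex_norm_square by (simp add: s_def algebra_simps)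
    finally show "\<beta> * cnj \<beta> * (D i r * cnj (D i r)) + \<beta> * s * (D i r * cnj (D i (r - 1))) +
        s * cnj \<beta> * (D i (r - 1) * cnj (D i r)) + s * s * (D i (r - 1) * cnj (D i (r - 1))) =
        complex_of_real (real (Suc i) * (cmod (D (Suc i) r))\<^sup>2)" by (rule sym)
  qed
  finally have "((\<lambda>i. real (Suc i) * (cmod (D (Suc i) r))\<^sup>2) has_sum (real r + (cmod \<beta>)\<^sup>2)) UNIV"
    unfolding has_sum_of_real_iff .
  then have "((\<lambda>i. real i * (cmod (D i r))\<^sup>2) has_sum (real r + (cmod \<beta>)\<^sup>2)) (range Suc)"
    by (subst has_sum_reindex) (auto simp: o_def)
  then show ?thesis
    unfolding D_def
  proof (subst has_sum_cong_neutral[where T = "range Suc"])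
    show "real i * (cmod (displacement \<beta> i r))\<^sup>2 = 0" if "i \<in> UNIV - range Suc" for i
      using that by (cases i) auto
  qed auto
qed

lemma ring_weight_mean:
  assumes N: "0 < N"
  shows "((\<lambda>i. real i * ring_weight N \<beta> i) has_sum (N + (cmod \<beta>)\<^sup>2)) UNIV"
proof -
  have "((\<lambda>i. \<Sum>\<^sub>\<infinity>r. thermal_weight N r * (real i * (cmod (displacement \<beta> i r))\<^sup>2)) has_sum (N + (cmod \<beta>)\<^sup>2)) UNIV"
  proof (rule has_sum_Tonelli(2))
    show "((\<lambda>i. thermal_weight N r * (real i * (cmod (displacement \<beta> i r))\<^sup>2)) has_sum
        thermal_weight N r * (real r + (cmod \<beta>)\<^sup>2)) UNIV" for r
      by (intro has_sum_cmult_right displacement_mean)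
    have "((\<lambda>r. real r * thermal_weight N r + (cmod \<beta>)\<^sup>2 * thermal_weight N r) has_sum (N + (cmod \<beta>)\<^sup>2 * 1)) UNIV"
      by (intro has_sum_add has_sum_cmult_right thermal_weight_mean thermal_weight_has_sum N)
    then show "((\<lambda>r. thermal_weight N r * (real r + (cmod \<beta>)\<^sup>2)) has_sum (N + (cmod \<beta>)\<^sup>2)) UNIV"
      by (simp add: algebra_simps)
  qed (use thermal_weight_nonneg[OF N] in auto)
  then show ?thesis
    by (simp add: ring_weight_def mult.left_commute[of _ "real _"] infsum_cmult_right')
qed

lemma thermal_displacement_diag:
  assumes N: "0 < N"
  shows "op_conjugate (displacement \<beta>) (thermal_state N) i i = of_real (ring_weight N \<beta> i)"
proof -
  have "((\<lambda>r. complex_of_real (thermal_weight N r * (cmod (displacement \<beta> i r))\<^sup>2)) has_sum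
      of_real (ring_weight N \<beta> i)) UNIV"
    unfolding ring_weight_def by (intro has_sum_of_real has_sum_infsum ring_weight_summable N)
  then have "((\<lambda>r. of_real (thermal_weight N r) * (displacement \<beta> i r * cnj (displacement \<beta> i r))) has_sum
      of_real (ring_weight N \<beta> i)) UNIV"
    by (simp add: complex_norm_square del: of_real_power)
  from has_sum_unique[OF thermal_displacement_has_sum[OF N] this] show ?thesis .
qed

text \<open>
  The kernel on the diagonal is a Laguerre polynomial at a negative argument; dropping the factorials
  \<open>1 / (i - k)!\<close> leaves a binomial expansion.
\<close>

lemma ring_weight_le:
  assumes N: "0 < N"
  shows "ring_weight N \<beta> i \<le> exp (- (cmod \<beta>)\<^sup>2 / (N + 1)) / (N + 1) *
    (N / (N + 1) * (1 + (cmod \<beta>)\<^sup>2 / (N * (N + 1)))) ^ i"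
proof -
  define b where "b = \<beta> / of_real (N + 1)"
  define q where "q = N / (N + 1)"
  define B where "B = (cmod b)\<^sup>2"
  have q: "0 \<le> q" "0 \<le> B" using N by (auto simp: q_def B_def)
  have term_eq: "fact i * (q ^ k * B ^ (i - k) / (fact k * fact (i - k) * fact (i - k))) =
      real (i choose k) * q ^ k * B ^ (i - k) / fact (i - k)" if "k \<le> i" for k
    unfolding binomial_fact[OF that, where 'a = real] by simp
  have bb: "b ^ n * cnj b ^ n = of_real (B ^ n)" for n
  proof -
    have "b * cnj b = of_real B" by (simp add: B_def complex_norm_square del: of_real_power)
    then show ?thesis by (metis power_mult_distrib of_real_power)
  qed
  have "kernel b (cnj b) (of_real q) i i =
      of_real (\<Sum>k\<le>i. fact i * (q ^ k * B ^ (i - k) / (fact k * fact (i - k) * fact (i - k))))"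
    unfolding kernel_def by (simp add: sum_distrib_left mult.assoc bb)
  also have "(\<Sum>k\<le>i. fact i * (q ^ k * B ^ (i - k) / (fact k * fact (i - k) * fact (i - k)))) =
      (\<Sum>k\<le>i. real (i choose k) * q ^ k * B ^ (i - k) / fact (i - k))"
    by (intro sum.cong refl term_eq) simp
  finally have kernel: "kernel b (cnj b) (of_real q) i i = of_real \<dots>" .
  have "ring_weight N \<beta> i = exp (- (cmod \<beta>)\<^sup>2 / (N + 1)) / (N + 1) *
      (\<Sum>k\<le>i. real (i choose k) * q ^ k * B ^ (i - k) / fact (i - k))"
    using thermal_displacement_diag[OF N, of \<beta> i, unfolded thermal_displacement_kernel[OF N], folded b_def q_def]
    unfolding kernel of_real_mult[symmetric] of_real_eq_iff by (rule sym)
  also have "\<dots> \<le> exp (- (cmod \<beta>)\<^sup>2 / (N + 1)) / (N + 1) * (\<Sum>k\<le>i. real (i choose k) * q ^ k * B ^ (i - k))"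
  proof (intro mult_left_mono sum_mono)
    fix k
    have "real (i choose k) * q ^ k * B ^ (i - k) / fact (i - k) \<le> real (i choose k) * q ^ k * B ^ (i - k) / 1"
      using q by (intro divide_left_mono) (auto simp: fact_ge_1)
    then show "real (i choose k) * q ^ k * B ^ (i - k) / fact (i - k) \<le> real (i choose k) * q ^ k * B ^ (i - k)"
      by simp
  qed (use N in auto)
  also have "(\<Sum>k\<le>i. real (i choose k) * q ^ k * B ^ (i - k)) = (q + B) ^ i"
    by (simp add: binomial_ring)
  also have "q + B = N / (N + 1) * (1 + (cmod \<beta>)\<^sup>2 / (N * (N + 1)))"
  proof -
    have "B = (cmod \<beta>)\<^sup>2 / (N + 1)\<^sup>2"
      using N by (simp add: B_def b_def norm_divide power_divide del: of_real_add)
    also have "\<dots> = N / (N + 1) * ((cmod \<beta>)\<^sup>2 / (N * (N + 1)))"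
      using N by (simp add: power2_eq_square)
    finally show ?thesis by (simp add: q_def distrib_left)
  qed
  finally show ?thesis .
qed

section \<open>Rotation covariance and the average over the phase\<close>

lemma displacement_rotate:
  assumes c: "c * cnj c = 1"
  shows "displacement (c * \<beta>) m n = c ^ m * cnj c ^ n * displacement \<beta> m n"
proof -
  have "cmod c = 1"
    using c by (metis complex_norm_square norm_one of_real_eq_1_iff power2_eq_1_iff norm_ge_zero
        of_real_1 zero_le_one abs_norm_cancel abs_one real_sqrt_unique)
  \<comment> \<open>Every summand of the kernel lacks equally many factors \<open>c\<close> and
    \<open>cnj c\<close>; these cancel in pairs, so the phase is common to all summands.\<close>
  moreover have "c ^ (m - k) * cnj c ^ (n - k) = c ^ m * cnj c ^ n" if "k \<le> min m n" for k
  proof -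
    have "c ^ m * cnj c ^ n = (c ^ (m - k) * c ^ k) * (cnj c ^ (n - k) * cnj c ^ k)"
      using that by (simp flip: power_add)
    also have "\<dots> = c ^ (m - k) * cnj c ^ (n - k) * (c * cnj c) ^ k"
      by (simp add: power_mult_distrib)
    finally show ?thesis using c by simp
  qed
  then have "kernel (c * \<beta>) (- cnj (c * \<beta>)) 1 m n = c ^ m * cnj c ^ n * kernel \<beta> (- cnj \<beta>) 1 m n"
    unfolding kernel_def sum_distrib_left
  proof (intro sum.cong refl)
    fix k assume k: "k \<in> {..min m n}"
    have e: "- cnj (c * \<beta>) = cnj c * - cnj \<beta>" by simp
    show "of_real (sqrt (fact m * fact n)) * (1 ^ k * (c * \<beta>) ^ (m - k) * (- cnj (c * \<beta>)) ^ (n - k) /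
          (fact k * fact (m - k) * fact (n - k))) =
        c ^ m * cnj c ^ n * (of_real (sqrt (fact m * fact n)) * (1 ^ k * \<beta> ^ (m - k) * (- cnj \<beta>) ^ (n - k) /
          (fact k * fact (m - k) * fact (n - k))))"
      unfolding e power_mult_distrib[of c] power_mult_distrib[of "cnj c"]
      using \<open>\<And>k. k \<le> min m n \<Longrightarrow> c ^ (m - k) * cnj c ^ (n - k) = c ^ m * cnj c ^ n\<close>[of k, symmetric] k
      by simp
  qed
  ultimately show ?thesis by (simp add: displacement_def norm_mult)
qed

text \<open>Rotating the amplitude conjugates the displacement by a diagonal unitary, which commutes
  with the thermal state; the phases at the inner index cancel.\<close>

lemma thermal_displacement_rotate:
  assumes c: "c * cnj c = 1"
  shows "op_conjugate (displacement (c * \<beta>)) (thermal_state N) i j =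
    c ^ i * cnj c ^ j * op_conjugate (displacement \<beta>) (thermal_state N) i j"
proof -
  have "(c ^ i * cnj c ^ r * displacement \<beta> i r) * x * cnj (c ^ j * cnj c ^ r * displacement \<beta> j r) =
      c ^ i * cnj c ^ j * (displacement \<beta> i r * x * cnj (displacement \<beta> j r))" for r x
  proof -
    have "(c ^ i * cnj c ^ r * displacement \<beta> i r) * x * cnj (c ^ j * cnj c ^ r * displacement \<beta> j r) =
        c ^ i * cnj c ^ j * (displacement \<beta> i r * x * cnj (displacement \<beta> j r)) * (c * cnj c) ^ r"
      by (simp add: power_mult_distrib)
    then show ?thesis by (simp add: c)
  qed
  then show ?thesis
    by (simp only: thermal_state_eq op_conjugate_diag displacement_rotate[OF c] infsum_cmult_right')
qed

lemma phase_average: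
  fixes K :: complex
  shows "(LBINT \<theta>:{0..2*pi}. exp (\<i> * of_real \<theta>) ^ i * cnj (exp (\<i> * of_real \<theta>)) ^ j * K) =
    (if i = j then of_real (2 * pi) * K else 0)"
proof -
  define k where "k = \<i> * (of_nat i - of_nat j)"
  have e: "exp (\<i> * of_real \<theta>) ^ i * cnj (exp (\<i> * of_real \<theta>)) ^ j = exp (k * of_real \<theta>)" for \<theta> :: real
    by (simp add: k_def exp_cnj exp_of_nat_mult[symmetric] exp_add[symmetric] algebra_simps)
  show ?thesis
  proof (cases "i = j")
    case True
    have "(LBINT \<theta>:{0..2*pi}. K) = of_real (2 * pi) * K - of_real 0 * K"
      unfolding set_lebesgue_integral_def
      by (rule integral_FTC_atLeastAtMost) (auto intro!: derivative_eq_intros simp: has_vector_derivative_def scaleR_conv_of_real)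
    then show ?thesis unfolding e using True by (simp add: k_def)
  next
    case False
    then have k: "k \<noteq> 0" by (simp add: k_def)
    have "(LBINT \<theta>:{0..2*pi}. exp (k * of_real \<theta>) * K) =
        exp (k * of_real (2 * pi)) / k * K - exp (k * of_real 0) / k * K"
      unfolding set_lebesgue_integral_def
    proof (rule integral_FTC_atLeastAtMost)
      fix \<theta> :: real
      have "((\<lambda>z. exp (k * z) / k * K) has_field_derivative exp (k * of_real \<theta>) * K) (at (of_real \<theta>))"
        using k by (auto intro!: derivative_eq_intros)
      then show "((\<lambda>\<theta>. exp (k * of_real \<theta>) / k * K) has_vector_derivative exp (k * of_real \<theta>) * K) (at \<theta> within {0..2*pi})"
        by (rule has_vector_derivative_at_within[OF has_vector_derivative_real_field])
    qed (auto intro!: continuous_intros)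
    \<comment> \<open>Undoing \<open>e\<close> turns the exponential into powers of
      \<open>exp (2 * pi * \<i>)\<close> and its conjugate.\<close>
    also have "exp (k * of_real (2 * pi)) = 1"
      unfolding e[symmetric] using exp_two_pi_i by (simp add: mult_ac)
    finally show ?thesis unfolding e using False by simp
  qed
qed

text \<open>The signal part of the average is already diagonal; this puts it into the form required
  by \<open>vn_entropy_tensor_coherent\<close>, with the identity as eigenbasis.\<close>

lemma op_conjugate_id_diag: "op_conjugate op_id (op_diag d) = op_diag d"
  unfolding op_id_def by (simp add: fun_eq_iff op_conjugate_diag_left)

lemma unitary_op_id: "unitary_op (op_id :: 'i oper)"
proof -
  have adj: "op_adj op_id = (op_id :: 'i oper)" by (simp add: fun_eq_iff op_adj_def op_id_def op_diag_def)
  have "op_mult op_id op_id i j = op_id i j" for i j :: 'i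
    unfolding op_mult_def op_id_def op_diag_def by (subst infsum_single_support[of i]) auto
  then show ?thesis by (simp add: unitary_op_def adj fun_eq_iff)
qed

lemma ring_average_split_coherent:
  assumes \<eta>: "0 < \<eta>" "\<eta> < 1" and N: "0 < N"
  shows "ring_average \<eta> N (split_coherent_state \<tau> \<alpha>) =
    op_tensor (op_diag (\<lambda>i. of_real (ring_weight ((1 - \<eta>) * N) (of_real (sqrt (\<eta> * \<tau>)) * \<alpha>) i)))
      (coherent_state (of_real (sqrt (1 - \<tau>)) * \<alpha>))"
proof (intro ext, clarify)
  fix i k j l
  define \<beta> where "\<beta> = of_real (sqrt (\<eta> * \<tau>)) * \<alpha>"
  define M where "M = (1 - \<eta>) * N"
  have M: "0 < M" using assms by (simp add: M_def)
  define G where "G = coherent_state (of_real (sqrt (1 - \<tau>)) * \<alpha>) k l"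
  define X where "X = op_conjugate (displacement \<beta>) (thermal_state M) i j"
  have "exp (\<i> * of_real \<theta>) * cnj (exp (\<i> * of_real \<theta>)) = 1" for \<theta> :: real
    by (simp add: exp_cnj exp_add[symmetric])
  then have "output_state \<eta> N (split_coherent_state \<tau> \<alpha>) \<theta> (i, k) (j, l) =
      exp (\<i> * of_real \<theta>) ^ i * cnj (exp (\<i> * of_real \<theta>)) ^ j * (X * G)" for \<theta>
    unfolding output_state_split_coherent[OF \<eta> N] \<beta>_def[symmetric] M_def[symmetric]
    by (simp only: op_tensor_def prod.case thermal_displacement_rotate X_def G_def mult.assoc)
  then have "ring_average \<eta> N (split_coherent_state \<tau> \<alpha>) (i, k) (j, l) = (if i = j then X * G else 0)"
    unfolding ring_average_def by (simp only: phase_average) simp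
  then show "ring_average \<eta> N (split_coherent_state \<tau> \<alpha>) (i, k) (j, l) =
      op_tensor (op_diag (\<lambda>i. of_real (ring_weight M \<beta> i)))
        (coherent_state (of_real (sqrt (1 - \<tau>)) * \<alpha>)) (i, k) (j, l)"
    by (auto simp: op_tensor_def op_diag_def G_def X_def thermal_displacement_diag[OF M])
qed

section \<open>Entropy bound for the average and conclusion\<close>

lemma ring_entropy_ge:
  fixes \<beta> :: complex
  assumes N: "0 < N"
  defines "S \<equiv> (cmod \<beta>)\<^sup>2"
  shows "ennreal ((ln ((N + 1) / N) - ln (1 + S / (N * (N + 1)))) * (N + S) + (ln (N + 1) + S / (N + 1))) \<le>
    (\<Sum>\<^sub>\<infinity>i. ennreal (- (ring_weight N \<beta> i * ln (ring_weight N \<beta> i))))"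
proof -
  define P where "P = ring_weight N \<beta>"
  \<comment> \<open>Minus the logarithm of the bound in \<open>ring_weight_le\<close> is
    \<open>A * real i + B\<close>: \<open>B\<close> comes from the prefactor, \<open>A\<close> from
    the base of the power.\<close>
  define A B where "A = ln ((N + 1) / N) - ln (1 + S / (N * (N + 1)))" and "B = ln (N + 1) + S / (N + 1)"
  define h where "h i = A * (real i * P i) + B * P i" for i
  have "(h has_sum (A * (N + S) + B * 1)) UNIV"
    unfolding h_def P_def S_def by (intro has_sum_add has_sum_cmult_right ring_weight_mean ring_weight_has_sum N)
  then have h: "(h has_sum (A * (N + S) + B)) UNIV" by simp
  have x: "0 < 1 + S / (N * (N + 1))"
    using N by (intro add_pos_nonneg divide_nonneg_pos) (auto simp: S_def)
  have h_le: "h i \<le> - (P i * ln (P i))" for i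
  proof (cases "P i = 0")
    case False
    then have P: "0 < P i" using ring_weight_nonneg[OF N, of \<beta> i] by (simp add: P_def)
    have "ln (P i) \<le> ln (exp (- S / (N + 1)) / (N + 1) * (N / (N + 1) * (1 + S / (N * (N + 1)))) ^ i)"
      using ring_weight_le[OF N, of \<beta> i] P by (intro ln_mono) (auto simp: P_def S_def)
    also have "\<dots> = - S / (N + 1) - ln (N + 1) + real i * (ln (N / (N + 1)) + ln (1 + S / (N * (N + 1))))"
      using N x by (subst ln_mult_pos ln_div ln_realpow, simp_all add: zero_less_mult_iff)+
    also have "\<dots> = - (A * real i + B)"
      using N by (simp add: ln_div A_def B_def algebra_simps)
    finally have "P i * ln (P i) \<le> P i * - (A * real i + B)"
      using P by (intro mult_left_mono) auto
    then show ?thesis by (simp add: h_def algebra_simps)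
  qed (simp add: h_def)
  \<comment> \<open>\<open>h\<close> has no fixed sign, while the entropy is a sum in
    \<open>ennreal\<close>. Passing to \<open>max 0 (h i)\<close> can only increase the sum, and
    \<open>ennreal\<close> sends it to the same value as \<open>h i\<close>.\<close>
  have abs_h: "(\<lambda>i. \<bar>h i\<bar>) summable_on UNIV"
    using has_sum_imp_summable[OF h] summable_on_iff_abs_summable_on_real by auto
  then have pos_h: "(\<lambda>i. max 0 (h i)) summable_on UNIV"
    by (rule summable_on_comparison_test) auto
  have "A * (N + S) + B \<le> (\<Sum>\<^sub>\<infinity>i. max 0 (h i))"
    unfolding infsumI[OF h, symmetric] by (intro infsum_mono has_sum_imp_summable[OF h] pos_h) auto
  then have "ennreal (A * (N + S) + B) \<le> (\<Sum>\<^sub>\<infinity>i. ennreal (max 0 (h i)))"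
    by (simp add: infsum_ennreal_of_real[OF pos_h] ennreal_leI)
  also have "\<dots> \<le> (\<Sum>\<^sub>\<infinity>i. ennreal (- (P i * ln (P i))))"
  proof (intro infsum_mono ennreal_summable_on)
    fix i
    have "ennreal (max 0 (h i)) = ennreal (h i)" by (simp add: max_def ennreal_neg)
    then show "ennreal (max 0 (h i)) \<le> ennreal (- (P i * ln (P i)))" using h_le[of i] by (simp add: ennreal_leI)
  qed
  finally show ?thesis by (simp only: A_def B_def P_def)
qed

theorem theorem2:
  fixes \<eta> \<tau> N\<^sub>B N\<^sub>T :: real and \<alpha> :: complex
  assumes "0 < \<eta>" "\<eta> < 1"
    and "0 \<le> \<tau>" "\<tau> \<le> 1"
    and "0 < N\<^sub>B"
    and "N\<^sub>T = (1 - \<eta>) * N\<^sub>B"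
    and "N\<^sub>T > \<eta> * \<tau> * (cmod \<alpha>)\<^sup>2 / 2 - 1"
  shows "holevo_ring \<eta> N\<^sub>B (split_coherent_state \<tau> \<alpha>) \<ge>
    ereal (\<eta> * \<tau> * (cmod \<alpha>)\<^sup>2 * (1 / (N\<^sub>T + 1) + ln ((N\<^sub>T + 1) / N\<^sub>T))
           - (N\<^sub>T + \<eta> * \<tau> * (cmod \<alpha>)\<^sup>2) * ln (1 + \<eta> * \<tau> * (cmod \<alpha>)\<^sup>2 / (N\<^sub>T * (N\<^sub>T + 1))))"
proof -
  define \<beta> where "\<beta> = of_real (sqrt (\<eta> * \<tau>)) * \<alpha>"
  define S where "S = \<eta> * \<tau> * (cmod \<alpha>)\<^sup>2"
  \<comment> \<open>\<open>g\<close> is the entropy of every output state and \<open>L\<close> the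
    bound for the average; in \<open>L - g\<close> the entropy of the thermal state cancels.\<close>
  define g where "g = N\<^sub>T * ln ((N\<^sub>T + 1) / N\<^sub>T) + ln (N\<^sub>T + 1)"
  define L where "L = (ln ((N\<^sub>T + 1) / N\<^sub>T) - ln (1 + S / (N\<^sub>T * (N\<^sub>T + 1)))) * (N\<^sub>T + S) + (ln (N\<^sub>T + 1) + S / (N\<^sub>T + 1))"
  have N: "0 < N\<^sub>T" using assms by simp
  have S: "(cmod \<beta>)\<^sup>2 = S"
    using assms by (simp add: \<beta>_def S_def norm_mult power_mult_distrib)
  have g: "0 \<le> g" using N by (simp add: g_def)
  have "vn_entropy (ring_average \<eta> N\<^sub>B (split_coherent_state \<tau> \<alpha>)) =
      (\<Sum>\<^sub>\<infinity>i. ennreal (- (ring_weight N\<^sub>T \<beta> i * ln (ring_weight N\<^sub>T \<beta> i))))"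
    using vn_entropy_tensor_coherent[OF unitary_op_id ring_weight_has_sum[OF N, of \<beta>] ring_weight_nonneg[OF N]]
    unfolding ring_average_split_coherent[OF assms(1,2,5)] op_conjugate_id_diag assms(6)[symmetric] \<beta>_def .
  then have avg: "ennreal L \<le> vn_entropy (ring_average \<eta> N\<^sub>B (split_coherent_state \<tau> \<alpha>))"
    using ring_entropy_ge[OF N, of \<beta>] unfolding S L_def by simp
  \<comment> \<open>Should \<open>L\<close> be negative, \<open>ennreal L\<close> is 0 and the
    inequality still holds.\<close>
  have "ereal L \<le> enn2ereal (ennreal L)"
    by (cases "0 \<le> L") (auto simp: ennreal_neg zero_ennreal.rep_eq)
  also have "\<dots> \<le> enn2ereal (vn_entropy (ring_average \<eta> N\<^sub>B (split_coherent_state \<tau> \<alpha>)))"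
    using avg by (simp add: less_eq_ennreal.rep_eq)
  finally have avg': "ereal L \<le> enn2ereal (vn_entropy (ring_average \<eta> N\<^sub>B (split_coherent_state \<tau> \<alpha>)))" .
  have "(\<integral>\<^sup>+\<theta>\<in>{0..2*pi}. vn_entropy (output_state \<eta> N\<^sub>B (split_coherent_state \<tau> \<alpha>) \<theta>) \<partial>lborel) =
      ennreal g * ennreal (2 * pi)"
    unfolding vn_entropy_output_state[OF assms(1,2,5)] assms(6)[symmetric] g_def[symmetric]
    by (subst nn_integral_cmult_indicator) auto
  then have "(\<integral>\<^sup>+\<theta>\<in>{0..2*pi}. vn_entropy (output_state \<eta> N\<^sub>B (split_coherent_state \<tau> \<alpha>) \<theta>) \<partial>lborel) /
      ennreal (2 * pi) = ennreal g"
    using g by (simp add: ennreal_mult[symmetric] divide_ennreal)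
  then have "holevo_ring \<eta> N\<^sub>B (split_coherent_state \<tau> \<alpha>) =
      enn2ereal (vn_entropy (ring_average \<eta> N\<^sub>B (split_coherent_state \<tau> \<alpha>))) - ereal g"
    using g by (simp add: holevo_ring_def)
  \<comment> \<open>Since \<open>g\<close> is a finite real, subtracting it is monotone even without
    knowing that the entropy of the average is finite.\<close>
  also have "\<dots> \<ge> ereal L - ereal g"
    by (rule ereal_minus_mono[OF avg' order_refl])
  finally have "ereal (L - g) \<le> holevo_ring \<eta> N\<^sub>B (split_coherent_state \<tau> \<alpha>)" by simp
  moreover have "L - g = S * (1 / (N\<^sub>T + 1) + ln ((N\<^sub>T + 1) / N\<^sub>T)) - (N\<^sub>T + S) * ln (1 + S / (N\<^sub>T * (N\<^sub>T + 1)))"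
    by (simp add: L_def g_def algebra_simps)
  ultimately show ?thesis by (simp only: S_def)
qed

end
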